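(* Let $\mathcal{G}=(\mathcal{V},\mathcal{E})$ be a strongly connected digraph with $\mathcal V=\{1,\dots,n\}$. Let $W\in\mathbb{R}^{n\times n}$ satisfy $W^2=W$ and $\operatorname{rank} W=k$ with $k\ge 1$, and let $T\in\mathbb{R}^{n\times n}$ be an invertible matrix such that $$W = T\begin{bmatrix} I_k & 0\\ 0 & 0\end{bmatrix}T^{-1},\qquad T=\begin{bmatrix} t_1 & \cdots & t_n\end{bmatrix},\qquad T^{-1}=\begin{bmatrix}\tau_1 & \cdots & \tau_n\end{bmatrix}^{\mathsf T},$$ with $t_i,\tau_i\in\mathbb{R}^n$. Let $a\in\mathbb{R}^{|\mathcal{E}|}$ and let $\mathbf{A}_{\mathcal{G}}(a)=[a_{ij}]$. Then $\dot x=\mathbf{A}_{\mathcal{G}}(a)x$ globally asymptotically reaches a $k$-dimensional agreement on $W$ if and only if the following two conditions hold simultaneously: (i) $\mathbf{A}_{\mathcal{G}}(a)\,t_i=0$ and $\tau_i^{\mathsf T}\mathbf{A}_{\mathcal{G}}(a)=0$ for all $i\in\{1,\dots,k\}$; (ii) the polynomial $\lambda^{n-k}+p_1\lambda^{n-k-1}+\cdots+p_{n-k}$, whose coefficients are defined by $$p_\ell=\sum_{\xi\in\mathcal{C}_\ell(\mathcal{G})}(-1)^{d(\xi)}\prod_{(i,j)\in\xi}a_{ij},\qquad \ell\in\{1,\dots,n-k\},$$ is stable.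
   Context: A digraph $\mathcal{G}=(\mathcal{V},\mathcal{E})$ has $\mathcal{V}=\{1,\dots,n\}$ and $\mathcal{E}\subseteq\mathcal{V}\times\mathcal{V}$ (self-loops allowed); $(i,j)\in\mathcal{E}$ denotes a directed edge from $j$ to $i$. It is strongly connected if for any $i,j\in\mathcal V$ there is a directed path from $i$ to $j$. A matrix $A=[a_{ij}]\in\mathbb{R}^{n\times n}$ is consistent with $\mathcal{G}$ if $(i,j)\notin\mathcal{E}$ implies $a_{ij}=0$. For $a\in\mathbb{R}^{|\mathcal{E}|}$ (a vector with one component $a_{ij}$ per edge $(i,j)\in\mathcal{E}$), $\mathbf{A}_{\mathcal{G}}(a)$ is the matrix consistent with $\mathcal{G}$ whose entry at position $(i,j)$ is $a_{ij}$ for $(i,j)\in\mathcal{E}$ and $0$ otherwise. A cycle is a closed directed path that visits no node other than the initial-final node more than once; its length is its number of edges (a self-loop is a cycle of length 1). A cycle family of length $\ell$ is a set of pairwise node-disjoint cycles whose lengths sum to $\ell$; $\mathcal{C}_\ell(\mathcal{G})$ is the set of all cycle families of length $\ell$ of $\mathcal{G}$, $d(\xi)$ is the number of cycles in the cycle family $\xi$, and $(i,j)\in\xi$ ranges over all edges of cycles in $\xi$ (an empty sum is $0$). A polynomial with real coefficients is stable if all its roots have negative real part. The system $\dot x=Ax$ globally asymptotically reaches a $k$-dimensional agreement on $W$ (where $\operatorname{rank}W=k$) if for every $x(0)\in\mathbb{R}^n$ the solution satisfies $\lim_{t\to\infty}x(t)=Wx(0)$. *)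

theory Defs
  imports
    Complex_Main
    "HOL-Computational_Algebra.Polynomial"
    "Graph_Theory.Digraph_Component"
    "Graph_Theory.Arc_Walk"
    "Jordan_Normal_Form.Matrix"
    "Jordan_Normal_Form.DL_Rank"
begin

section \<open>Digraphs on \<open>n\<close> nodes and cycle families\<close>

text \<open>
  Nodes are numbered from 0, in accordance with the indexing of matrices.
  A pair \<open>(i, j)\<close> is the edge from \<open>j\<close> to \<open>i\<close>, so its tail is the second component.
\<close>

definition digraph_of :: "nat \<Rightarrow> (nat \<times> nat) set \<Rightarrow> (nat, nat \<times> nat) pre_digraph" where
  "digraph_of n E = \<lparr>verts = {0..<n}, arcs = E, tail = snd, head = fst\<rparr>"

definition edge_matrix :: "nat \<Rightarrow> (nat \<times> nat) set \<Rightarrow> (nat \<times> nat \<Rightarrow> real) \<Rightarrow> real mat" where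
  "edge_matrix n E a = mat n n (\<lambda>(i, j). if (i, j) \<in> E then a (i, j) else 0)"

text \<open>
  A cycle is represented by its set of edges, which identifies the closed walks
  that differ only in the choice of the initial node.
  In particular, its length is the cardinality of that set.
\<close>

definition edge_cycles :: "('v, 'e) pre_digraph \<Rightarrow> 'e set set" where
  "edge_cycles G = {set p | p. pre_digraph.cycle G p}"

definition node_set :: "('v, 'e) pre_digraph \<Rightarrow> 'e set \<Rightarrow> 'v set" where
  "node_set G c = tail G ` c \<union> head G ` c"

definition cycle_families :: "('v, 'e) pre_digraph \<Rightarrow> nat \<Rightarrow> 'e set set set" where
  "cycle_families G l =
    {F. F \<subseteq> edge_cycles G
      \<and> pairwise (\<lambda>c d. disjnt (node_set G c) (node_set G d)) F
      \<and> (\<Sum>c\<in>F. card c) = l}"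

definition family_coeff :: "('v, 'e) pre_digraph \<Rightarrow> ('e \<Rightarrow> real) \<Rightarrow> nat \<Rightarrow> real" where
  "family_coeff G a l = (\<Sum>F\<in>cycle_families G l. (- 1) ^ card F * (\<Prod>e\<in>\<Union>F. a e))"

definition family_poly :: "('v, 'e) pre_digraph \<Rightarrow> ('e \<Rightarrow> real) \<Rightarrow> nat \<Rightarrow> real poly" where
  "family_poly G a m = monom 1 m + (\<Sum>l = 1..m. monom (family_coeff G a l) (m - l))"

definition stable_poly :: "real poly \<Rightarrow> bool" where
  "stable_poly p \<longleftrightarrow> (\<forall>z::complex. poly (map_poly complex_of_real p) z = 0 \<longrightarrow> Re z < 0)"

section \<open>Agreement of linear systems\<close>

text \<open>
  The type of vectors carries no topology, so derivatives and limits are taken componentwise.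
\<close>

definition linear_solution :: "nat \<Rightarrow> real mat \<Rightarrow> (real \<Rightarrow> real vec) \<Rightarrow> bool" where
  "linear_solution n A x \<longleftrightarrow>
    (\<forall>t\<ge>0. x t \<in> carrier_vec n) \<and>
    (\<forall>t\<ge>0. \<forall>i<n. ((\<lambda>s. vec_index (x s) i) has_real_derivative vec_index (A *\<^sub>v x t) i)
                   (at t within {0..}))"

definition reaches_agreement :: "nat \<Rightarrow> nat \<Rightarrow> real mat \<Rightarrow> real mat \<Rightarrow> bool" where
  "reaches_agreement n k A W \<longleftrightarrow>
    vec_space.rank n W = k \<and>
    (\<forall>x0 \<in> carrier_vec n. \<forall>x. linear_solution n A x \<and> x 0 = x0 \<longrightarrow>
      (\<forall>i<n. ((\<lambda>t. vec_index (x t) i) \<longlongrightarrow> vec_index (W *\<^sub>v x0) i) at_top))"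

end

theory Submission
  imports
    Defs
    "HOL-Combinatorics.Cycles"
    "HOL-Combinatorics.Orbits"
    "HOL-Analysis.Derivative"
    "Jordan_Normal_Form.Schur_Decomposition"
begin

text \<open>
  The idea is to replace \<open>A\<close> by the deflated matrix \<open>A - W\<close>. The conditions on the \<open>t_i\<close> and \<open>\<tau>_i\<close>
  say exactly that \<open>A W = 0\<close> and \<open>W A = 0\<close> (\<open>annihilates_projection_iff\<close>). Under these two equations
  \<open>A\<close> is, in the basis \<open>T\<close>, block diagonal with a zero block of size \<open>k\<close>, and \<open>A - W\<close> has \<open>- 1\<close> in
  place of that block. Hence the characteristic polynomials are \<open>X ^ k q\<close> and \<open>(X + 1) ^ k q\<close> with the
  same \<open>q\<close> of degree \<open>n - k\<close> (\<open>char_poly_deflation\<close>).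

  The link to the digraph is the coefficient theorem \<open>coeff_char_poly_edge_matrix\<close>: cycle families of
  length \<open>l\<close> with weights \<open>(- 1) ^ d \<Prod> a\<close> sum to the coefficient of \<open>X ^ (n - l)\<close> in \<open>det (X - A)\<close>.
  It comes from a bijection between cycle families and permutations of subsets of the nodes, given by the
  cycle decomposition (\<open>bij_betw_orbit_graphs\<close>). Reading off the coefficients shows that \<open>q\<close> is the
  polynomial of the theorem, so its stability is that of \<open>A - W\<close>.

  It remains to see that agreement on \<open>W\<close> is equivalent to \<open>A W = W A = 0\<close> with \<open>A - W\<close> Hurwitz
  (\<open>agreement_iff_deflation_stable\<close>). If the latter holds, \<open>W x\<close> is constant along solutions and
  \<open>x - W x(0)\<close> solves the system of \<open>A - W\<close>, whose solutions decay: a Schur decomposition reduces the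
  decay to scalar equations with a vanishing forcing term. Conversely, if every solution tends to
  \<open>W x(0)\<close>, its derivative \<open>A x\<close> tends to zero, which gives \<open>A W = 0\<close>, and since \<open>A x\<close> is again a
  solution, also \<open>W A = 0\<close>. An unstable eigenvector of \<open>A - W\<close> is then an eigenvector of \<open>A\<close> killed by
  \<open>W\<close>, and its exponential solution does not tend to zero.
\<close>

section \<open>Cycle families and permutations of node sets\<close>

text \<open>
  Since \<open>(i, j)\<close> is the edge from \<open>j\<close> to \<open>i\<close>, the graph of a permutation \<open>f\<close> of a node set collects
  the edges \<open>(i, f i)\<close>, whose weights are exactly the matrix entries that \<open>f\<close> selects in the
  Leibniz expansion of a determinant.
\<close>

definition fun_graph :: "('v \<Rightarrow> 'w) \<Rightarrow> 'v set \<Rightarrow> ('v \<times> 'w) set" where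
  "fun_graph f S = (\<lambda>x. (x, f x)) ` S"

lemma fun_graph_cong: "(\<And>x. x \<in> S \<Longrightarrow> f x = g x) \<Longrightarrow> fun_graph f S = fun_graph g S"
  by (auto simp: fun_graph_def)

lemma card_fun_graph: "card (fun_graph f S) = card S"
  unfolding fun_graph_def by (rule card_image) (auto intro: inj_onI)

lemma prod_fun_graph: "(\<Prod>e\<in>fun_graph f S. a e) = (\<Prod>x\<in>S. a (x, f x))"
  unfolding fun_graph_def by (subst prod.reindex) (auto intro: inj_onI)

lemma cas_digraph_of_iff:
  "pre_digraph.cas (digraph_of n E) u p v \<longleftrightarrow> map snd p @ [v] = u # map fst p"
  by (induction p arbitrary: u)
     (auto simp: pre_digraph.cas.simps digraph_of_def)

lemma cycle_digraph_of_iff: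
  "pre_digraph.cycle (digraph_of n E) p \<longleftrightarrow>
    p \<noteq> [] \<and> set p \<subseteq> E \<and> distinct (map fst p) \<and>
    (\<exists>u<n. map snd p @ [u] = u # map fst p)"
proof -
  have "tl (pre_digraph.awalk_verts (digraph_of n E) u p) = map fst p"
    if "pre_digraph.cas (digraph_of n E) u p v" "p \<noteq> []" for u v
    using that by (subst pre_digraph.awalk_verts_conv') (auto simp: digraph_of_def)
  then show ?thesis
    unfolding pre_digraph.cycle_def pre_digraph.awalk_def cas_digraph_of_iff
    by (auto simp: digraph_of_def)
qed

lemma map_cycle_of_list: "distinct cs \<Longrightarrow> map (cycle_of_list cs) cs = rotate1 cs"
  using cyclic_rotation[of cs 1] by simp

text \<open>
  A walk along the edges \<open>(i, f i)\<close> traverses the cycle of \<open>f\<close> backwards. Hence the nodes are listed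
  in the reverse order of the heads of the walk; the sequence of tails is then a rotation of that list,
  which is what \<^const>\<open>cycle_of_list\<close> does to its list.
\<close>

lemma edge_cycles_digraph_of:
  assumes "E \<subseteq> {0..<n} \<times> {0..<n}"
  shows "c \<in> edge_cycles (digraph_of n E) \<longleftrightarrow>
    (\<exists>cs. cs \<noteq> [] \<and> distinct cs \<and> c = fun_graph (cycle_of_list cs) (set cs) \<and> c \<subseteq> E)"
proof
  assume "c \<in> edge_cycles (digraph_of n E)"
  then obtain p u where p: "p \<noteq> []" "set p \<subseteq> E" "distinct (map fst p)"
      "map snd p @ [u] = u # map fst p" and c: "c = set p"
    by (auto simp: edge_cycles_def cycle_digraph_of_iff)
  define cs where "cs = rev (map fst p)"
  have "rev (map snd p @ [u]) = rev (u # map fst p)" by (simp only: p)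
  then have "u # rev (map snd p) = cs @ [u]" by (simp add: cs_def)
  moreover have ne: "cs \<noteq> []" and d: "distinct cs" using p by (auto simp: cs_def)
  ultimately have "rev (map snd p) = rotate1 cs" by (cases cs) auto
  then have "rev (map snd p) = map (cycle_of_list cs) cs" using d by (simp add: map_cycle_of_list)
  then have "rev p = map (\<lambda>x. (x, cycle_of_list cs x)) cs"
    by (intro nth_equalityI) (auto simp: cs_def rev_map prod_eq_iff list_eq_iff_nth_eq)
  then have "set (rev p) = fun_graph (cycle_of_list cs) (set cs)" by (simp add: fun_graph_def)
  with ne d p c show "\<exists>cs. cs \<noteq> [] \<and> distinct cs \<and> c = fun_graph (cycle_of_list cs) (set cs) \<and> c \<subseteq> E"
    by auto
next
  assume "\<exists>cs. cs \<noteq> [] \<and> distinct cs \<and> c = fun_graph (cycle_of_list cs) (set cs) \<and> c \<subseteq> E"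
  then obtain cs where cs: "cs \<noteq> []" "distinct cs" "c = fun_graph (cycle_of_list cs) (set cs)" "c \<subseteq> E"
    by blast
  define p where "p = rev (map (\<lambda>x. (x, cycle_of_list cs x)) cs)"
  have sp: "set p = c" by (simp add: p_def cs fun_graph_def)
  have fst: "map fst p = rev cs" by (simp add: p_def rev_map comp_def)
  have "map snd p = rev (map (cycle_of_list cs) cs)" by (simp add: p_def rev_map comp_def)
  then have snd: "map snd p = rev (rotate1 cs)" using cs by (simp add: map_cycle_of_list)
  have "map snd p @ [hd cs] = hd cs # map fst p"
    unfolding fst snd using cs(1) by (cases cs) auto
  moreover have "hd cs < n"
    using cs assms by (cases cs) (auto simp: fun_graph_def)
  moreover have "p \<noteq> []" using cs by (simp add: p_def)
  ultimately have "pre_digraph.cycle (digraph_of n E) p"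
    unfolding cycle_digraph_of_iff using cs sp fst by auto
  then show "c \<in> edge_cycles (digraph_of n E)"
    using sp unfolding edge_cycles_def by blast
qed

lemma node_set_fun_graph:
  assumes "f permutes S"
  shows "node_set (digraph_of n E) (fun_graph f S) = S"
  using permutes_image[OF assms]
  by (auto simp: node_set_def digraph_of_def fun_graph_def image_image)

lemma sign_cycle_of_list:
  "distinct cs \<Longrightarrow> cs \<noteq> [] \<Longrightarrow> sign (cycle_of_list cs) = (- 1) ^ Suc (length cs)"
proof (induction cs rule: cycle_of_list.induct)
  case (1 i j cs)
  have "sign (cycle_of_list (i # j # cs)) = sign (Transposition.transpose i j) * sign (cycle_of_list (j # cs))"
    unfolding cycle_of_list.simps(1)
    by (rule sign_compose[OF permutation_swap_id permutation_of_cycle])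
  also have "\<dots> = (- 1) ^ Suc (length (i # j # cs))" using 1 by (simp add: sign_swap_id)
  finally show ?case .
qed auto

lemma orbit_cycle_of_list:
  assumes "distinct cs" "x \<in> set cs" "\<And>y. y \<in> set cs \<Longrightarrow> f y = cycle_of_list cs y"
  shows "orbit f x = set cs"
proof -
  let ?g = "cycle_of_list cs"
  have perm: "?g permutes set cs" by (rule cycle_permutes)
  have self: "z \<in> orbit ?g z" for z
    by (rule permutation_self_in_orbit[OF permutation_of_cycle])
  have "set cs \<subseteq> orbit ?g x"
  proof
    fix y assume "y \<in> set cs"
    obtain i where i: "i < length cs" "x = cs ! i" using assms by (metis in_set_conv_nth)
    obtain j where j: "j < length cs" "y = cs ! j" using \<open>y \<in> set cs\<close> by (metis in_set_conv_nth)
    define m where "m = length cs - i + j"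
    have "(?g ^^ m) x = map (?g ^^ m) cs ! i" using i by simp
    also have "\<dots> = rotate m cs ! i" using cyclic_rotation[OF assms(1)] by simp
    also have "\<dots> = cs ! ((m + i) mod length cs)" using i by (simp add: nth_rotate)
    also have "(m + i) mod length cs = j" using i j by (simp add: m_def)
    finally have "y = (?g ^^ m) x" using j by simp
    then show "y \<in> orbit ?g x" using funpow_in_orbit[OF self] by simp
  qed
  moreover have "orbit ?g x \<subseteq> set cs" by (rule permutes_orbit_subset[OF perm assms(2)])
  ultimately have eq: "orbit ?g x = set cs" by auto
  have "orbit f x = orbit ?g x"
    by (rule orbit_cong[OF self]) (use assms eq in auto)
  with eq show ?thesis by simp
qed

text \<open>
  A cycle family is determined by the union of its cycles: if the union is the graph of \<open>f\<close>, then each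
  cycle through \<open>x\<close> is a cyclic permutation that agrees with \<open>f\<close>, so its nodes are the orbit of \<open>x\<close>.
  This is the uniqueness of the cycle decomposition.
\<close>

lemma family_eq_orbit_graphs:
  assumes "E \<subseteq> {0..<n} \<times> {0..<n}" and F: "F \<subseteq> edge_cycles (digraph_of n E)"
    and U: "\<Union>F = fun_graph f S"
  shows "F = (\<lambda>x. fun_graph f (orbit f x)) ` S"
proof -
  have key: "c = fun_graph f (orbit f x)" if c: "c \<in> F" and xy: "(x, y) \<in> c" for c x y
  proof -
    obtain cs where cs: "distinct cs" "c = fun_graph (cycle_of_list cs) (set cs)"
      using edge_cycles_digraph_of[OF assms(1), of c] F c by auto
    have x: "x \<in> set cs" using xy cs by (auto simp: fun_graph_def)
    have "c \<subseteq> fun_graph f S" using U c by blast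
    then have eq: "f y = cycle_of_list cs y" if "y \<in> set cs" for y
      using that cs(2) by (auto simp: fun_graph_def)
    have "orbit f x = set cs" using cs(1) x eq by (rule orbit_cycle_of_list)
    moreover have "fun_graph f (set cs) = fun_graph (cycle_of_list cs) (set cs)"
      by (rule fun_graph_cong) (rule eq)
    ultimately show ?thesis using cs(2) by simp
  qed
  show ?thesis
  proof (intro equalityI subsetI)
    fix c assume c: "c \<in> F"
    then obtain cs where cs: "cs \<noteq> []" "c = fun_graph (cycle_of_list cs) (set cs)"
      using edge_cycles_digraph_of[OF assms(1), of c] F by auto
    then have xc: "(hd cs, cycle_of_list cs (hd cs)) \<in> c" by (auto simp: fun_graph_def)
    then have "hd cs \<in> S" using U c by (auto simp: fun_graph_def)
    then show "c \<in> (\<lambda>x. fun_graph f (orbit f x)) ` S" using key[OF c xc] by blast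
  next
    fix c assume "c \<in> (\<lambda>x. fun_graph f (orbit f x)) ` S"
    then obtain x where x: "x \<in> S" "c = fun_graph f (orbit f x)" by blast
    then have "(x, f x) \<in> \<Union>F" using U by (auto simp: fun_graph_def)
    then obtain d where "d \<in> F" "(x, f x) \<in> d" by blast
    then show "c \<in> F" using key x by metis
  qed
qed

text \<open>
  The induction adds one cycle at a time. A cycle of length \<open>m\<close> has the sign \<open>(- 1) ^ (m - 1)\<close>, so each
  cycle contributes its length plus one to the exponent. This turns the sign of the permutation into
  the sign \<open>(- 1) ^ card F\<close> of the coefficient formula, up to \<open>(- 1) ^ card S\<close>. Fixed points in \<open>S\<close>
  count as cycles of length one, the self-loops.
\<close>

lemma permutation_of_family:
  assumes E: "E \<subseteq> {0..<n} \<times> {0..<n}"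
    and "finite F" "F \<subseteq> edge_cycles (digraph_of n E)"
    and "pairwise (\<lambda>c d. disjnt (node_set (digraph_of n E) c) (node_set (digraph_of n E) d)) F"
  shows "\<exists>f S. S \<subseteq> {0..<n} \<and> f permutes S \<and> \<Union>F = fun_graph f S \<and> (\<Sum>c\<in>F. card c) = card S
    \<and> sign f = (- 1) ^ (card S + card F)"
  using assms(2-)
proof (induction F rule: finite_induct)
  case empty
  show ?case by (intro exI[of _ id] exI[of _ "{}"]) (auto simp: fun_graph_def)
next
  case (insert c F)
  let ?N = "node_set (digraph_of n E)"
  obtain f S where fS: "S \<subseteq> {0..<n}" "f permutes S" "\<Union>F = fun_graph f S"
      "(\<Sum>c\<in>F. card c) = card S" "sign f = (- 1) ^ (card S + card F)"
    using insert by (auto simp: pairwise_insert)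
  obtain cs where cs: "cs \<noteq> []" "distinct cs" "c = fun_graph (cycle_of_list cs) (set cs)" "c \<subseteq> E"
    using insert.prems edge_cycles_digraph_of[OF E] by auto
  let ?g = "cycle_of_list cs"
  have g: "?g permutes set cs" by (rule cycle_permutes)
  have fin: "finite S" using fS(1) finite_subset by blast
  have nF: "(\<Union>d\<in>F. ?N d) = S"
  proof -
    have "(\<Union>d\<in>F. ?N d) = ?N (\<Union>F)" by (auto simp: node_set_def)
    then show ?thesis using fS node_set_fun_graph by simp
  qed
  have "disjnt (?N c) (?N d)" if "d \<in> F" for d
    using insert that by (auto simp: pairwise_insert)
  then have disj: "set cs \<inter> S = {}"
    using nF node_set_fun_graph[OF g, of n E] cs(3) by (fastforce simp: disjnt_def)
  have "set cs \<union> S \<subseteq> {0..<n}" using cs E fS(1) by (auto simp: fun_graph_def)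
  moreover have "(?g \<circ> f) permutes (set cs \<union> S)"
    by (rule permutes_compose) (use g fS in \<open>auto intro: permutes_subset\<close>)
  moreover have "\<Union>(insert c F) = fun_graph (?g \<circ> f) (set cs \<union> S)"
  proof -
    have "fun_graph (?g \<circ> f) (set cs) = fun_graph ?g (set cs)"
      by (rule fun_graph_cong) (use disj fS(2) in \<open>auto simp: permutes_def\<close>)
    moreover have "fun_graph (?g \<circ> f) S = fun_graph f S"
      by (rule fun_graph_cong)
         (use disj permutes_in_image[OF fS(2)] in \<open>auto intro!: id_outside_supp\<close>)
    ultimately have "fun_graph (?g \<circ> f) (set cs \<union> S) = fun_graph ?g (set cs) \<union> fun_graph f S"
      by (simp add: fun_graph_def image_Un)
    then show ?thesis using cs fS by simp
  qed
  moreover have "(\<Sum>c\<in>insert c F. card c) = card (set cs \<union> S)"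
    using insert cs fS disj fin by (simp add: card_fun_graph card_Un_disjoint)
  moreover have "sign (?g \<circ> f) = (- 1) ^ (card (set cs \<union> S) + card (insert c F))"
  proof -
    have "permutation f" using fS(2) fin permutation_permutes by blast
    then have "sign (?g \<circ> f) = sign ?g * sign f"
      by (rule sign_compose[OF permutation_of_cycle])
    also have "\<dots> = (- 1) ^ (card (set cs \<union> S) + card (insert c F))"
      using insert cs fS disj fin
      by (simp add: sign_cycle_of_list card_Un_disjoint distinct_card power_add)
    finally show ?thesis .
  qed
  ultimately show ?case
    by (intro exI[of _ "?g \<circ> f"] exI[of _ "set cs \<union> S"] conjI)
qed

lemma family_of_permutation:
  assumes E: "E \<subseteq> {0..<n} \<times> {0..<n}"
    and "f permutes S" "finite S" "fun_graph f S \<subseteq> E"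
  shows "\<exists>F. F \<subseteq> edge_cycles (digraph_of n E) \<and> \<Union>F = fun_graph f S \<and>
    pairwise (\<lambda>c d. disjnt (node_set (digraph_of n E) c) (node_set (digraph_of n E) d)) F"
proof -
  let ?N = "node_set (digraph_of n E)"
  have "cycle_decomp S f" using assms by (simp add: cycle_decomposition)
  then have "f permutes S \<and> (fun_graph f S \<subseteq> E \<longrightarrow>
     (\<exists>F. F \<subseteq> edge_cycles (digraph_of n E) \<and> \<Union>F = fun_graph f S \<and>
       pairwise (\<lambda>c d. disjnt (?N c) (?N d)) F))"
  proof (induction rule: cycle_decomp.induct)
    case empty
    show ?case by (auto intro!: exI[of _ "{}"] simp: fun_graph_def permutes_def)
  next
    case (comp S f cs)
    let ?g = "cycle_of_list cs"
    have f: "f permutes S" using comp by blast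
    have g: "?g permutes set cs" by (rule cycle_permutes)
    have gf: "(?g \<circ> f) permutes (set cs \<union> S)"
      by (rule permutes_compose) (use g f in \<open>auto intro: permutes_subset\<close>)
    have g1: "fun_graph (?g \<circ> f) (set cs) = fun_graph ?g (set cs)"
      by (rule fun_graph_cong) (use comp f in \<open>auto simp: permutes_def\<close>)
    have g2: "fun_graph (?g \<circ> f) S = fun_graph f S"
      by (rule fun_graph_cong)
         (use comp permutes_in_image[OF f] in \<open>auto intro!: id_outside_supp\<close>)
    have un: "fun_graph (?g \<circ> f) (set cs \<union> S) = fun_graph ?g (set cs) \<union> fun_graph f S"
      using g1 g2 by (simp add: fun_graph_def image_Un)
    show ?case
    proof (intro conjI impI gf)
      assume sub: "fun_graph (?g \<circ> f) (set cs \<union> S) \<subseteq> E"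
      then obtain F where F: "F \<subseteq> edge_cycles (digraph_of n E)" "\<Union>F = fun_graph f S"
          "pairwise (\<lambda>c d. disjnt (?N c) (?N d)) F"
        using comp un by auto
      show "\<exists>F. F \<subseteq> edge_cycles (digraph_of n E) \<and> \<Union>F = fun_graph (?g \<circ> f) (set cs \<union> S) \<and>
        pairwise (\<lambda>c d. disjnt (?N c) (?N d)) F"
      proof (cases "cs = []")
        case True
        with F show ?thesis by auto
      next
        case False
        let ?c = "fun_graph ?g (set cs)"
        have "?c \<in> edge_cycles (digraph_of n E)"
          using edge_cycles_digraph_of[OF E] False comp un sub by blast
        moreover have "disjnt (?N ?c) (?N d)" if "d \<in> F" for d
        proof -
          have "?N d \<subseteq> ?N (\<Union>F)" using that by (auto simp: node_set_def)
          then have "?N d \<subseteq> S" using F node_set_fun_graph[OF f] by simp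
          then show ?thesis using node_set_fun_graph[OF g] comp by (auto simp: disjnt_def)
        qed
        ultimately show ?thesis using F un
          by (intro exI[of _ "insert ?c F"]) (auto simp: pairwise_insert disjnt_sym)
      qed
    qed
  qed
  with assms show ?thesis by blast
qed

lemma finite_family:
  assumes "E \<subseteq> {0..<n} \<times> {0..<n}" and "F \<subseteq> edge_cycles (digraph_of n E)"
  shows "finite F"
proof (rule finite_subset)
  show "F \<subseteq> Pow E" using assms(2) edge_cycles_digraph_of[OF assms(1)] by blast
  show "finite (Pow E)" using assms(1) finite_subset by blast
qed

lemma fun_graph_permutes_inject:
  assumes f: "f permutes S" and g: "g permutes R" and eq: "fun_graph f S = fun_graph g R"
  shows "S = R \<and> f = g"
proof -
  have "S = fst ` fun_graph f S" "R = fst ` fun_graph g R" by (force simp: fun_graph_def)+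
  then have S: "S = R" using eq by simp
  have "f x = g x" for x
    using assms S by (cases "x \<in> S") (auto simp: fun_graph_def permutes_not_in)
  then show ?thesis using S by auto
qed

lemma orbit_graphs_of_permutation:
  assumes E: "E \<subseteq> {0..<n} \<times> {0..<n}"
    and S: "S \<subseteq> {0..<n}" and f: "f permutes S" "fun_graph f S \<subseteq> E"
  defines "F \<equiv> (\<lambda>x. fun_graph f (orbit f x)) ` S"
  shows "F \<in> cycle_families (digraph_of n E) (card S)" and "\<Union>F = fun_graph f S"
    and "(- 1) ^ card F = sign f * (- 1) ^ card S"
proof -
  let ?N = "node_set (digraph_of n E)"
  obtain F' where F': "F' \<subseteq> edge_cycles (digraph_of n E)" "\<Union>F' = fun_graph f S"
      "pairwise (\<lambda>c d. disjnt (?N c) (?N d)) F'"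
    using family_of_permutation[OF E f(1) _ f(2)] S finite_subset by blast
  have "F' = F" unfolding F_def by (rule family_eq_orbit_graphs[OF E F'(1,2)])
  note F = F'[unfolded this]
  obtain g R where gR: "g permutes R" "\<Union>F = fun_graph g R" "(\<Sum>c\<in>F. card c) = card R"
      "sign g = (- 1) ^ (card R + card F)"
    using permutation_of_family[OF E finite_family[OF E F(1)] F(1,3)] by blast
  have "S = R \<and> f = g" using fun_graph_permutes_inject[OF f(1) gR(1)] F(2) gR(2) by simp
  then have "(\<Sum>c\<in>F. card c) = card S" "sign f = (- 1) ^ (card S + card F)" using gR by auto
  then show "F \<in> cycle_families (digraph_of n E) (card S)" "\<Union>F = fun_graph f S"
      "(- 1) ^ card F = sign f * (- 1) ^ card S"
    using F by (auto simp: cycle_families_def power_add)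
qed

text \<open>
  The pair \<open>(S, f)\<close> carries the node set because a fixed point of \<open>f\<close> may be covered by a
  self-loop or not covered at all; the permutation alone does not tell these cases apart.
\<close>

lemma bij_betw_orbit_graphs:
  assumes E: "E \<subseteq> {0..<n} \<times> {0..<n}"
  shows "bij_betw (\<lambda>(S, f). (\<lambda>x. fun_graph f (orbit f x)) ` S)
    (SIGMA S:{S. S \<subseteq> {0..<n} \<and> card S = l}. {f. f permutes S \<and> fun_graph f S \<subseteq> E})
    (cycle_families (digraph_of n E) l)" (is "bij_betw ?h ?P ?Q")
proof (rule bij_betwI')
  fix p q assume pq: "p \<in> ?P" "q \<in> ?P"
  obtain S f where p: "p = (S, f)" by (cases p)
  obtain R g where q: "q = (R, g)" by (cases q)
  have "p = q" if "?h p = ?h q"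
  proof -
    have "fun_graph f S = \<Union>(?h p)"
      using orbit_graphs_of_permutation(2)[OF E, of S f] pq p by simp
    also have "\<dots> = fun_graph g R"
      unfolding that using orbit_graphs_of_permutation(2)[OF E, of R g] pq q by simp
    finally show ?thesis using fun_graph_permutes_inject[of f S g R] pq p q by simp
  qed
  then show "?h p = ?h q \<longleftrightarrow> p = q" by blast
next
  fix p assume "p \<in> ?P"
  then show "?h p \<in> ?Q" using orbit_graphs_of_permutation(1)[OF E] by auto
next
  fix F assume "F \<in> ?Q"
  then have F: "F \<subseteq> edge_cycles (digraph_of n E)" "(\<Sum>c\<in>F. card c) = l"
      "pairwise (\<lambda>c d. disjnt (node_set (digraph_of n E) c) (node_set (digraph_of n E) d)) F"
    by (auto simp: cycle_families_def)
  obtain f S where *: "S \<subseteq> {0..<n}" "f permutes S" "\<Union>F = fun_graph f S" "(\<Sum>c\<in>F. card c) = card S"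
    using permutation_of_family[OF E finite_family[OF E F(1)] F(1,3)] by blast
  have "fun_graph f S \<subseteq> E" using F(1) *(3) edge_cycles_digraph_of[OF E] by blast
  then have "(S, f) \<in> ?P" using * F by auto
  moreover have "F = ?h (S, f)" using family_eq_orbit_graphs[OF E F(1) *(3)] by simp
  ultimately show "\<exists>p\<in>?P. F = ?h p" by blast
qed

section \<open>The coefficients of the characteristic polynomial\<close>

text \<open>
  In the Leibniz expansion of \<open>det (X - A)\<close>, a diagonal factor selected by \<open>f\<close> is a sum of \<open>X\<close> and
  \<open>- a\<close>. Multiplying out, \<open>S\<close> is the set of positions where the matrix entry is taken. The other
  positions must be fixed points, so that only permutations of \<open>S\<close> survive.
\<close>

lemma char_poly_subset_expansion:
  fixes A :: "'a :: comm_ring_1 mat"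
  assumes A: "A \<in> carrier_mat n n"
  shows "char_poly A = (\<Sum>S\<in>Pow {0..<n}. \<Sum>f | f permutes S.
    monom (of_int (sign f) * (- 1) ^ card S * (\<Prod>i\<in>S. A $$ (i, f i))) (n - card S))"
proof -
  let ?N = "{0..<n}"
  let ?t = "\<lambda>S f. monom (of_int (sign f) * (- 1) ^ card S * (\<Prod>i\<in>S. A $$ (i, f i))) (n - card S)"
  have "char_poly A = (\<Sum>f | f permutes ?N. of_int (sign f) *
      (\<Prod>i = 0..<n. char_poly_matrix A $$ (i, f i)))"
    unfolding char_poly_def by (rule det_def'[of _ n]) (use A in simp)
  also have "\<dots> = (\<Sum>f | f permutes ?N. \<Sum>S\<in>Pow ?N. if f permutes S then ?t S f else 0)"
  proof (rule sum.cong[OF refl])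
    fix f assume "f \<in> {f. f permutes ?N}"
    then have f: "f permutes ?N" by simp
    have "(\<Prod>i = 0..<n. char_poly_matrix A $$ (i, f i)) =
        (\<Prod>i\<in>?N. [:- A $$ (i, f i):] + (if f i = i then monom 1 1 else 0))"
    proof (rule prod.cong[OF refl])
      fix i assume "i \<in> ?N"
      moreover then have "f i < n" using permutes_in_image[OF f] by simp
      ultimately show "char_poly_matrix A $$ (i, f i) =
          [:- A $$ (i, f i):] + (if f i = i then monom 1 1 else 0)"
        using A by (auto simp: char_poly_matrix_def monom_altdef)
    qed
    also have "\<dots> = (\<Sum>S\<in>Pow ?N. (\<Prod>i\<in>S. [:- A $$ (i, f i):]) *
        (\<Prod>i\<in>?N - S. if f i = i then monom 1 1 else 0))"
      by (rule prod_add) simp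
    finally have "of_int (sign f) * (\<Prod>i = 0..<n. char_poly_matrix A $$ (i, f i)) =
      (\<Sum>S\<in>Pow ?N. of_int (sign f) * ((\<Prod>i\<in>S. [:- A $$ (i, f i):]) *
        (\<Prod>i\<in>?N - S. if f i = i then monom 1 1 else 0)))"
      by (simp add: sum_distrib_left)
    also have "\<dots> = (\<Sum>S\<in>Pow ?N. if f permutes S then ?t S f else 0)"
    proof (rule sum.cong[OF refl])
      fix S assume "S \<in> Pow ?N"
      then have S: "S \<subseteq> ?N" "finite S" by (auto intro: finite_subset)
      show "of_int (sign f) * ((\<Prod>i\<in>S. [:- A $$ (i, f i):]) *
          (\<Prod>i\<in>?N - S. if f i = i then monom 1 1 else 0)) = (if f permutes S then ?t S f else 0)"
      proof (cases "f permutes S")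
        case True
        have "(\<Prod>i\<in>?N - S. if f i = i then monom 1 1 else 0) = (\<Prod>i\<in>?N - S. monom (1::'a) 1)"
          using True by (intro prod.cong) (auto simp: permutes_def)
        also have "\<dots> = monom 1 (n - card S)"
          using S by (simp add: card_Diff_subset monom_power)
        finally have 1: "(\<Prod>i\<in>?N - S. if f i = i then monom 1 1 else 0) = monom (1::'a) (n - card S)" .
        have 2: "(\<Prod>i\<in>S. [:- A $$ (i, f i):]) = [: (- 1) ^ card S * (\<Prod>i\<in>S. A $$ (i, f i)) :]"
          using S(2) by (induction S rule: finite_induct) (auto simp: one_pCons mult_ac)
        have 3: "(of_int (sign f) :: 'a poly) = [: of_int (sign f) :]"
          by (simp add: of_int_poly)
        show ?thesis unfolding 1 2 3 using True
          by (simp add: smult_monom mult_ac)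
      next
        case False
        then obtain i where "i \<notin> S" "f i \<noteq> i" using f
          by (metis permutes_superset Diff_iff)
        moreover then have "i \<in> ?N" using f by (meson permutes_not_in)
        ultimately have "(\<Prod>i\<in>?N - S. if f i = i then monom 1 1 else (0 :: 'a poly)) = 0"
          by (intro prod_zero) auto
        then show ?thesis using False by simp
      qed
    qed
    finally show "of_int (sign f) * (\<Prod>i = 0..<n. char_poly_matrix A $$ (i, f i)) =
      (\<Sum>S\<in>Pow ?N. if f permutes S then ?t S f else 0)" .
  qed
  also have "\<dots> = (\<Sum>S\<in>Pow ?N. \<Sum>f | f permutes ?N. if f permutes S then ?t S f else 0)"
    by (rule sum.swap)
  also have "\<dots> = (\<Sum>S\<in>Pow ?N. \<Sum>f | f permutes S. ?t S f)"
  proof (rule sum.cong[OF refl])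
    fix S assume "S \<in> Pow ?N"
    then have "{f. f permutes S} \<subseteq> {f. f permutes ?N}" by (auto intro: permutes_subset)
    then show "(\<Sum>f | f permutes ?N. if f permutes S then ?t S f else 0) = (\<Sum>f | f permutes S. ?t S f)"
      by (intro sum.mono_neutral_cong_right) (auto simp: finite_permutations)
  qed
  finally show ?thesis .
qed

text \<open>
  The coefficient theorem for weighted digraphs: the cycle families of length \<open>l\<close> compute the
  coefficient of \<open>X ^ (n - l)\<close>.
\<close>

lemma coeff_char_poly_edge_matrix:
  assumes E: "E \<subseteq> {0..<n} \<times> {0..<n}" and l: "l \<le> n"
  shows "coeff (char_poly (edge_matrix n E a)) (n - l) = family_coeff (digraph_of n E) a l"
proof -
  let ?A = "edge_matrix n E a"
  let ?N = "{0..<n}"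
  let ?u = "\<lambda>S f. of_int (sign f) * (- 1) ^ card S * (\<Prod>i\<in>S. ?A $$ (i, f i))"
  let ?h = "\<lambda>(S, f). (\<lambda>x. fun_graph f (orbit f x)) ` S"
  let ?C = "{S. S \<subseteq> ?N \<and> card S = l}"
  have A: "?A \<in> carrier_mat n n" by (simp add: edge_matrix_def)
  have finC: "finite ?C" by (rule finite_subset[of _ "Pow ?N"]) auto
  have finP: "finite {f. f permutes S}" if "S \<in> ?C" for S
    by (rule finite_permutations) (use that finite_subset in blast)
  have cC: "card S \<le> n" if "S \<subseteq> ?N" for S using card_mono[OF _ that] by simp
  have "coeff (char_poly ?A) (n - l) =
      (\<Sum>S\<in>Pow ?N. \<Sum>f | f permutes S. if card S = l then ?u S f else 0)"
    unfolding char_poly_subset_expansion[OF A] coeff_sum coeff_monom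
    using cC l by (intro sum.cong) (auto, (metis diff_diff_cancel)+)
  also have "\<dots> = (\<Sum>S\<in>?C. \<Sum>f | f permutes S. ?u S f)"
    by (rule sum.mono_neutral_cong_right) auto
  also have "\<dots> = (\<Sum>S\<in>?C. \<Sum>f | f permutes S \<and> fun_graph f S \<subseteq> E. ?u S f)"
  proof (rule sum.cong[OF refl], rule sum.mono_neutral_right)
    fix S assume S: "S \<in> ?C"
    then have fS: "finite S" using finite_subset by blast
    show "\<forall>f\<in>{f. f permutes S} - {f. f permutes S \<and> fun_graph f S \<subseteq> E}. ?u S f = 0"
    proof
      fix f assume "f \<in> {f. f permutes S} - {f. f permutes S \<and> fun_graph f S \<subseteq> E}"
      then obtain i where i: "f permutes S" "i \<in> S" "(i, f i) \<notin> E" by (auto simp: fun_graph_def)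
      then have "i < n" "f i < n" using S permutes_in_image[OF i(1), of i] by auto
      then have "?A $$ (i, f i) = 0" using i by (simp add: edge_matrix_def)
      then have "(\<Prod>i\<in>S. ?A $$ (i, f i)) = 0" using fS i by (intro prod_zero) auto
      then show "?u S f = 0" by simp
    qed
  qed (use finP in auto)
  also have "\<dots> = (\<Sum>(S, f)\<in>(SIGMA S:?C. {f. f permutes S \<and> fun_graph f S \<subseteq> E}). ?u S f)"
    by (rule sum.Sigma) (use finC finP in \<open>auto intro: finite_subset[OF _ finP]\<close>)
  also have "\<dots> = (\<Sum>x\<in>(SIGMA S:?C. {f. f permutes S \<and> fun_graph f S \<subseteq> E}).
      (- 1) ^ card (?h x) * (\<Prod>e\<in>\<Union>(?h x). a e))"
  proof (rule sum.cong[OF refl])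
    fix x assume "x \<in> (SIGMA S:?C. {f. f permutes S \<and> fun_graph f S \<subseteq> E})"
    then obtain S f where x: "x = (S, f)" and S: "S \<subseteq> ?N" and f: "f permutes S" "fun_graph f S \<subseteq> E"
      by blast
    have u: "\<Union>(?h (S, f)) = fun_graph f S"
      and s: "(- 1) ^ card (?h (S, f)) = sign f * (- 1) ^ card S"
      using orbit_graphs_of_permutation(2,3)[OF E S f] by auto
    have "(- 1) ^ card (?h (S, f)) = (of_int ((- 1) ^ card (?h (S, f))) :: real)" by simp
    also have "\<dots> = of_int (sign f) * (- 1) ^ card S" by (simp only: s) simp
    finally have s': "(- 1) ^ card (?h (S, f)) = (of_int (sign f) * (- 1) ^ card S :: real)" .
    have "(\<Prod>i\<in>S. ?A $$ (i, f i)) = (\<Prod>i\<in>S. a (i, f i))"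
    proof (rule prod.cong[OF refl])
      fix i assume "i \<in> S"
      moreover then have "i < n" "f i < n" using S permutes_in_image[OF f(1), of i] by auto
      ultimately show "?A $$ (i, f i) = a (i, f i)" using f by (auto simp: edge_matrix_def fun_graph_def)
    qed
    then have "?u S f = (- 1) ^ card (?h (S, f)) * (\<Prod>e\<in>\<Union>(?h (S, f)). a e)"
      unfolding u s' prod_fun_graph by simp
    then show "(case x of (S, f) \<Rightarrow> ?u S f) = (- 1) ^ card (?h x) * (\<Prod>e\<in>\<Union>(?h x). a e)"
      unfolding x by simp
  qed
  also have "\<dots> = family_coeff (digraph_of n E) a l"
    unfolding family_coeff_def
    by (rule sum.reindex_bij_betw[OF bij_betw_orbit_graphs[OF E]])
  finally show ?thesis .
qed

section \<open>Decay and existence of solutions of linear systems\<close>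

text \<open>
  With \<open>u t = exp (- c t) w t\<close> the equation becomes \<open>u' = exp (- c t) g\<close>. Once \<open>g\<close> is below
  \<open>\<delta>\<close>, the mean value inequality compares \<open>u\<close> with a primitive of \<open>\<delta> exp (\<mu> t)\<close>, where
  \<open>\<mu> = - Re c\<close>, which makes integration unnecessary.
\<close>

lemma forced_scalar_ode_tendsto_0:
  fixes w g :: "real \<Rightarrow> complex" and c :: complex
  assumes deriv: "\<And>t. t \<ge> 0 \<Longrightarrow> (w has_vector_derivative c * w t + g t) (at t within {0..})"
    and c: "Re c < 0" and g: "(g \<longlongrightarrow> 0) at_top"
  shows "(w \<longlongrightarrow> 0) at_top"
proof (rule tendstoI)
  fix \<epsilon> :: real assume "\<epsilon> > 0"
  define \<mu> where "\<mu> = - Re c"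
  \<comment> \<open>forcing of size \<open>\<delta>\<close> contributes at most \<open>\<delta> / \<mu>\<close> to \<open>w\<close> in the long run\<close>
  define \<delta> where "\<delta> = \<mu> * \<epsilon> / 2"
  have \<mu>: "\<mu> > 0" and \<delta>: "\<delta> > 0" using c \<open>\<epsilon> > 0\<close> by (auto simp: \<mu>_def \<delta>_def mult_neg_pos)
  obtain T where T: "T > 0" "\<And>t. t \<ge> T \<Longrightarrow> norm (g t) \<le> \<delta>"
  proof -
    have "\<forall>\<^sub>F t in at_top. norm (g t) < \<delta>" using tendstoD[OF g \<delta>] by simp
    then obtain T0 where T0: "\<And>t. t \<ge> T0 \<Longrightarrow> norm (g t) < \<delta>"
      by (auto simp: eventually_at_top_linorder)
    show ?thesis by (rule that[of "max T0 1"]) (use T0 in \<open>auto intro: less_imp_le\<close>)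
  qed
  define u where "u t = exp (- c * of_real t) * w t" for t
  have du: "(u has_vector_derivative exp (- c * of_real t) * g t) (at t)" if "t > 0" for t
  proof -
    have "(w has_vector_derivative c * w t + g t) (at t within {0<..})"
      by (rule has_vector_derivative_within_subset[OF deriv]) (use that in auto)
    then have w: "(w has_vector_derivative c * w t + g t) (at t)"
      using that by (simp add: at_within_open[of t "{0<..}"])
    have "((\<lambda>z. exp (- c * z)) has_field_derivative - c * exp (- c * of_real t)) (at (of_real t))"
      by (auto intro!: derivative_eq_intros)
    then have "((\<lambda>s. exp (- c * of_real s)) has_vector_derivative - c * exp (- c * of_real t)) (at t)"
      by (rule has_vector_derivative_real_field)
    from has_vector_derivative_mult[OF this w] show ?thesis
      unfolding u_def by (simp add: algebra_simps)
  qed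
  have bound: "norm (w t) \<le> exp (- \<mu> * (t - T)) * norm (w T) + \<epsilon> / 2" if t: "t > T" for t
  proof -
    have cont: "continuous_on {T..t} u"
    proof (rule continuous_at_imp_continuous_on, rule ballI)
      fix s assume "s \<in> {T..t}"
      then show "isCont u s" using T du[of s] by (intro has_vector_derivative_continuous) auto
    qed
    have "norm (u t - u T) \<le> \<delta> / \<mu> * exp (\<mu> * t) - \<delta> / \<mu> * exp (\<mu> * T)"
    proof (rule differentiable_bound_general[OF t cont])
      show "continuous_on {T..t} (\<lambda>s. \<delta> / \<mu> * exp (\<mu> * s))" by (intro continuous_intros)
      show "(u has_vector_derivative exp (- c * of_real s) * g s) (at s)" if "T < s" for s
        using du that T by auto
      show "((\<lambda>s. \<delta> / \<mu> * exp (\<mu> * s)) has_vector_derivative \<delta> * exp (\<mu> * s)) (at s)" for s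
        unfolding has_real_derivative_iff_has_vector_derivative[symmetric]
        using \<mu> by (auto intro!: derivative_eq_intros)
      show "norm (exp (- c * of_real s) * g s) \<le> \<delta> * exp (\<mu> * s)" if "T < s" for s
        using T(2)[of s] that by (simp add: norm_mult \<mu>_def)
    qed
    also have "\<dots> \<le> \<delta> / \<mu> * exp (\<mu> * t)" using \<mu> \<delta> by simp
    finally have "norm (u t) \<le> norm (u T) + \<delta> / \<mu> * exp (\<mu> * t)"
      using norm_triangle_ineq2[of "u t" "u T"] by linarith
    then have "exp (\<mu> * t) * norm (w t) \<le> exp (\<mu> * T) * norm (w T) + \<delta> / \<mu> * exp (\<mu> * t)"
      by (simp add: u_def norm_mult \<mu>_def)
    then have "exp (- (\<mu> * t)) * (exp (\<mu> * t) * norm (w t)) \<le>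
        exp (- (\<mu> * t)) * (exp (\<mu> * T) * norm (w T) + \<delta> / \<mu> * exp (\<mu> * t))"
      by (intro mult_left_mono) auto
    also have "exp (- (\<mu> * t)) * (exp (\<mu> * t) * norm (w t)) = norm (w t)"
      by (simp add: exp_minus)
    also have "exp (- (\<mu> * t)) * (exp (\<mu> * T) * norm (w T) + \<delta> / \<mu> * exp (\<mu> * t)) =
        exp (- \<mu> * (t - T)) * norm (w T) + \<epsilon> / 2"
      using \<mu> by (simp add: \<delta>_def exp_minus exp_diff right_diff_distrib field_simps)
    finally show ?thesis .
  qed
  have "((\<lambda>t. exp (- \<mu> * (t - T)) * norm (w T)) \<longlongrightarrow> 0) at_top"
  proof -
    have "filterlim (\<lambda>t. - \<mu> * (t - T)) at_bot at_top"
    proof -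
      have "filterlim (\<lambda>t. - T + t) at_top at_top"
        by (rule filterlim_tendsto_add_at_top[OF tendsto_const filterlim_ident])
      then have "filterlim (\<lambda>t. - \<mu> * (- T + t)) at_bot at_top"
        by (intro filterlim_tendsto_neg_mult_at_bot[OF tendsto_const]) (use \<mu> in auto)
      then show ?thesis by simp
    qed
    then have "((\<lambda>t. exp (- \<mu> * (t - T))) \<longlongrightarrow> 0) at_top"
      by (rule filterlim_compose[OF exp_at_bot])
    from tendsto_mult_right[OF this, of "norm (w T)"] show ?thesis by simp
  qed
  then have "\<forall>\<^sub>F t in at_top. exp (- \<mu> * (t - T)) * norm (w T) < \<epsilon> / 2"
    by (rule order_tendstoD) (use \<open>\<epsilon> > 0\<close> in simp)
  then show "\<forall>\<^sub>F t in at_top. dist (w t) 0 < \<epsilon>"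
    using eventually_gt_at_top[of T]
    by eventually_elim (use bound in \<open>fastforce simp: dist_norm\<close>)
qed

text \<open>
  Back substitution: the components after \<open>i\<close> tend to zero and act as a vanishing forcing term in the
  scalar equation for component \<open>i\<close>.
\<close>

lemma upper_triangular_solution_tendsto_0:
  fixes U :: "complex mat" and z :: "real \<Rightarrow> nat \<Rightarrow> complex"
  assumes U: "U \<in> carrier_mat n n" "upper_triangular U"
    and diag: "\<And>i. i < n \<Longrightarrow> Re (U $$ (i, i)) < 0"
    and deriv: "\<And>i t. i < n \<Longrightarrow> t \<ge> 0 \<Longrightarrow>
      ((\<lambda>s. z s i) has_vector_derivative (\<Sum>j = 0..<n. U $$ (i, j) * z t j)) (at t within {0..})"
    and "i < n"
  shows "((\<lambda>t. z t i) \<longlongrightarrow> 0) at_top"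
  using \<open>i < n\<close>
proof (induction "n - i" arbitrary: i rule: less_induct)
  case less
  let ?g = "\<lambda>t. \<Sum>j = Suc i..<n. U $$ (i, j) * z t j"
  have sum: "(\<Sum>j = 0..<n. U $$ (i, j) * z t j) = U $$ (i, i) * z t i + ?g t" for t
  proof -
    have "(\<Sum>j = 0..<n. U $$ (i, j) * z t j) = (\<Sum>j = i..<n. U $$ (i, j) * z t j)"
    proof (rule sum.mono_neutral_right)
      show "\<forall>j\<in>{0..<n} - {i..<n}. U $$ (i, j) * z t j = 0"
        using upper_triangularD[OF U(2)] U(1) less.prems by auto
    qed auto
    then show ?thesis using less.prems by (simp add: sum.atLeast_Suc_lessThan)
  qed
  have "(?g \<longlongrightarrow> (\<Sum>j = Suc i..<n. U $$ (i, j) * 0)) at_top"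
    by (intro tendsto_sum tendsto_mult_left less.hyps) (use less.prems in auto)
  then have "(?g \<longlongrightarrow> 0) at_top" by simp
  then show ?case
    using forced_scalar_ode_tendsto_0[where w = "\<lambda>t. z t i" and g = ?g and c = "U $$ (i, i)"]
      deriv[OF less.prems] diag[OF less.prems] unfolding sum by blast
qed

lemma index_mult_mat_vec_sum:
  "A \<in> carrier_mat n m \<Longrightarrow> v \<in> carrier_vec m \<Longrightarrow> i < n \<Longrightarrow>
    vec_index (A *\<^sub>v v) i = (\<Sum>j = 0..<m. A $$ (i, j) * vec_index v j)"
  by (auto simp: scalar_prod_def intro!: sum.cong)

lemma stable_char_poly_iff:
  fixes A :: "real mat"
  assumes A: "A \<in> carrier_mat n n"
  shows "stable_poly (char_poly A) \<longleftrightarrow>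
    (\<forall>z. eigenvalue (map_mat complex_of_real A) z \<longrightarrow> Re z < 0)"
proof -
  have "map_mat complex_of_real A \<in> carrier_mat n n" using A by simp
  from eigenvalue_root_char_poly[OF this] show ?thesis
    unfolding stable_poly_def of_real_hom.char_poly_hom[OF A] by simp
qed

text \<open>
  A complex Schur decomposition makes the system upper triangular. Its diagonal consists of the
  eigenvalues of \<open>A\<close>, so the decay follows by back substitution.
\<close>

lemma stable_solution_tendsto_0:
  fixes A :: "real mat"
  assumes A: "A \<in> carrier_mat n n" and stable: "stable_poly (char_poly A)"
    and x: "linear_solution n A x" and "i < n"
  shows "((\<lambda>t. vec_index (x t) i) \<longlongrightarrow> 0) at_top"
proof -
  let ?A = "map_mat complex_of_real A"
  have cA: "?A \<in> carrier_mat n n" using A by simp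
  obtain es where "char_poly ?A = (\<Prod>e\<leftarrow>es. [:- e, 1:])" using char_poly_factorized[OF cA] by blast
  from schur_decomposition_exists[OF cA this] obtain U where
    U: "U \<in> carrier_mat n n" "upper_triangular U" "similar_mat ?A U" by blast
  from similar_matD[OF U(3)] obtain m P Q where
    "{?A, U, P, Q} \<subseteq> carrier_mat m m" "P * Q = 1\<^sub>m m" "Q * P = 1\<^sub>m m" "?A = P * U * Q" by blast
  then have PQ: "P \<in> carrier_mat n n" "Q \<in> carrier_mat n n" "P * Q = 1\<^sub>m n" "Q * P = 1\<^sub>m n" "?A = P * U * Q"
    using U(1) by auto
  have diag: "Re (U $$ (j, j)) < 0" if "j < n" for j
  proof -
    have "poly (char_poly ?A) (U $$ (j, j)) = 0"
      unfolding char_poly_similar[OF U(3)] char_poly_upper_triangular[OF U(1,2)] poly_prod_list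
      using U(1) that by (auto simp: diag_mat_def prod_list_zero_iff)
    then show ?thesis
      using stable eigenvalue_root_char_poly[OF cA] unfolding stable_char_poly_iff[OF A] by blast
  qed
  define y where "y t = map_vec complex_of_real (x t)" for t
  have xc: "x t \<in> carrier_vec n" if "t \<ge> 0" for t using x that by (simp add: linear_solution_def)
  have dy: "((\<lambda>s. vec_index (y s) j) has_vector_derivative vec_index (?A *\<^sub>v y t) j) (at t within {0..})"
    if "j < n" "t \<ge> 0" for j t
  proof -
    have "((\<lambda>s. vec_index (x s) j) has_real_derivative vec_index (A *\<^sub>v x t) j) (at t within {0..})"
      using x that by (simp add: linear_solution_def)
    then have "((\<lambda>s. complex_of_real (vec_index (x s) j)) has_vector_derivative
        complex_of_real (vec_index (A *\<^sub>v x t) j)) (at t within {0..})"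
      by (rule has_vector_derivative_of_real)
    moreover have "complex_of_real (vec_index (A *\<^sub>v x t) j) = vec_index (?A *\<^sub>v y t) j"
    proof -
      have "vec_index (map_vec complex_of_real (A *\<^sub>v x t)) j = vec_index (?A *\<^sub>v y t) j"
        unfolding y_def by (simp only: of_real_hom.mult_mat_vec_hom[OF A xc[OF that(2)]])
      then show ?thesis using A that by simp
    qed
    ultimately have "((\<lambda>s. complex_of_real (vec_index (x s) j)) has_vector_derivative
        vec_index (?A *\<^sub>v y t) j) (at t within {0..})" by simp
    then show ?thesis
      by (rule has_vector_derivative_transform[rotated 2])
         (use that in \<open>auto simp: y_def carrier_vecD[OF xc]\<close>)
  qed
  define z where "z t = Q *\<^sub>v y t" for t
  have yc: "y t \<in> carrier_vec n" if "t \<ge> 0" for t using xc[OF that] by (simp add: y_def)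
  have zc: "z t \<in> carrier_vec n" for t unfolding z_def by (rule carrier_vecI) (use PQ in simp)
  have z_index: "vec_index (z t) j = (\<Sum>l = 0..<n. Q $$ (j, l) * vec_index (y t) l)" if "t \<ge> 0" "j < n" for t j
    unfolding z_def by (rule index_mult_mat_vec_sum[OF PQ(2) yc[OF that(1)] that(2)])
  have y_z: "y t = P *\<^sub>v z t" if "t \<ge> 0" for t
    unfolding z_def assoc_mult_mat_vec[OF PQ(1,2) yc[OF that], symmetric] PQ(3)
    using yc[OF that] by simp
  have dz: "((\<lambda>s. vec_index (z s) j) has_vector_derivative (\<Sum>l = 0..<n. U $$ (j, l) * vec_index (z t) l))
      (at t within {0..})" if "j < n" "t \<ge> 0" for j t
  proof -
    have Ay: "?A *\<^sub>v y t \<in> carrier_vec n" by (rule mult_mat_vec_carrier[OF cA yc[OF that(2)]])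
    have "((\<lambda>s. \<Sum>l = 0..<n. Q $$ (j, l) * vec_index (y s) l) has_vector_derivative
        (\<Sum>l = 0..<n. Q $$ (j, l) * vec_index (?A *\<^sub>v y t) l)) (at t within {0..})"
      by (intro has_vector_derivative_sum has_vector_derivative_mult_right dy) (use that in auto)
    also have "(\<Sum>l = 0..<n. Q $$ (j, l) * vec_index (?A *\<^sub>v y t) l) = vec_index (Q *\<^sub>v (?A *\<^sub>v y t)) j"
      by (rule index_mult_mat_vec_sum[OF PQ(2) Ay that(1), symmetric])
    also have "Q *\<^sub>v (?A *\<^sub>v y t) = (Q * ?A) *\<^sub>v y t"
      by (rule assoc_mult_mat_vec[symmetric, OF PQ(2) cA yc[OF that(2)]])
    also have "Q * ?A = U * Q"
    proof -
      have "Q * ?A = Q * (P * (U * Q))" unfolding PQ(5) using PQ U by simp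
      also have "\<dots> = (Q * P) * (U * Q)" using PQ(1,2) U(1) by (simp add: assoc_mult_mat[of _ n n _ n _ n])
      finally show ?thesis using PQ U by simp
    qed
    also have "(U * Q) *\<^sub>v y t = U *\<^sub>v z t"
      unfolding z_def by (rule assoc_mult_mat_vec[OF U(1) PQ(2) yc[OF that(2)]])
    also have "vec_index (U *\<^sub>v z t) j = (\<Sum>l = 0..<n. U $$ (j, l) * vec_index (z t) l)"
      by (rule index_mult_mat_vec_sum[OF U(1) zc that(1)])
    finally show ?thesis
      by (rule has_vector_derivative_transform[rotated 2]) (use that z_index in auto)
  qed
  have z0: "((\<lambda>t. vec_index (z t) j) \<longlongrightarrow> 0) at_top" if "j < n" for j
    by (rule upper_triangular_solution_tendsto_0[where z = "\<lambda>t j. vec_index (z t) j", OF U(1,2) diag dz that])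
  have "((\<lambda>t. \<Sum>l = 0..<n. P $$ (i, l) * vec_index (z t) l) \<longlongrightarrow> (\<Sum>l = 0..<n. P $$ (i, l) * 0)) at_top"
    by (intro tendsto_sum tendsto_mult_left z0) auto
  then have "((\<lambda>t. Re (\<Sum>l = 0..<n. P $$ (i, l) * vec_index (z t) l)) \<longlongrightarrow> 0) at_top"
    using tendsto_Re by fastforce
  moreover have "\<forall>\<^sub>F t in at_top. Re (\<Sum>l = 0..<n. P $$ (i, l) * vec_index (z t) l) = vec_index (x t) i"
    using eventually_ge_at_top[of 0]
  proof eventually_elim
    case (elim t)
    have "(\<Sum>l = 0..<n. P $$ (i, l) * vec_index (z t) l) = vec_index (y t) i"
      unfolding y_z[OF elim] by (rule index_mult_mat_vec_sum[OF PQ(1) zc \<open>i < n\<close>, symmetric])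
    then show ?case using xc[OF elim] \<open>i < n\<close> by (simp add: y_def)
  qed
  ultimately show ?thesis by (rule Lim_transform_eventually)
qed

text \<open>
  The solution is the exponential series, taken componentwise: \<open>v m\<close> is the vector \<open>A\<^sup>m x0\<close>, whose
  entries grow at most geometrically.
\<close>

lemma linear_solution_exists:
  fixes A :: "real mat"
  assumes A: "A \<in> carrier_mat n n" and x0: "x0 \<in> carrier_vec n"
  obtains x where "linear_solution n A x" "x 0 = x0"
proof -
  define v where "v m = ((\<lambda>u. A *\<^sub>v u) ^^ m) x0" for m
  have vc: "v m \<in> carrier_vec n" for m
    by (induction m) (auto simp: v_def x0 intro: mult_mat_vec_carrier[OF A])
  have v_Suc: "v (Suc m) = A *\<^sub>v v m" for m by (simp add: v_def)
  define K where "K = (\<Sum>i = 0..<n. \<Sum>j = 0..<n. \<bar>A $$ (i, j)\<bar>)"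
  define C where "C = (\<Sum>i = 0..<n. \<bar>vec_index x0 i\<bar>)"
  have K0: "K \<ge> 0" and C0: "C \<ge> 0" by (auto simp: K_def C_def intro!: sum_nonneg)
  have bound: "\<bar>vec_index (v m) i\<bar> \<le> C * K ^ m" if "i < n" for m i
    using that
  proof (induction m arbitrary: i)
    case 0
    then show ?case unfolding C_def v_def
      by (auto intro!: member_le_sum[where f = "\<lambda>i. \<bar>vec_index x0 i\<bar>"])
  next
    case (Suc m)
    have "\<bar>vec_index (v (Suc m)) i\<bar> = \<bar>\<Sum>j = 0..<n. A $$ (i, j) * vec_index (v m) j\<bar>"
      unfolding v_Suc using index_mult_mat_vec_sum[OF A vc Suc.prems] by simp
    also have "\<dots> \<le> (\<Sum>j = 0..<n. \<bar>A $$ (i, j)\<bar> * (C * K ^ m))"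
      by (rule order_trans[OF sum_abs sum_mono])
         (use Suc.IH in \<open>auto simp: abs_mult intro!: mult_left_mono\<close>)
    also have "\<dots> = (\<Sum>j = 0..<n. \<bar>A $$ (i, j)\<bar>) * (C * K ^ m)"
      by (simp add: sum_distrib_right)
    also have "\<dots> \<le> K * (C * K ^ m)"
    proof (rule mult_right_mono)
      show "(\<Sum>j = 0..<n. \<bar>A $$ (i, j)\<bar>) \<le> K" unfolding K_def
        by (rule member_le_sum[where f = "\<lambda>i. \<Sum>j = 0..<n. \<bar>A $$ (i, j)\<bar>"])
           (use Suc.prems in \<open>auto intro: sum_nonneg\<close>)
    qed (use K0 C0 in auto)
    finally show ?case by (simp add: mult_ac)
  qed
  define c where "c i m = vec_index (v m) i / fact m" for i m
  have summ: "summable (\<lambda>m. c i m * t ^ m)" if "i < n" for i and t :: real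
  proof (rule summable_comparison_test')
    show "summable (\<lambda>m. C * ((K * \<bar>t\<bar>) ^ m /\<^sub>R fact m))"
      by (intro summable_mult summable_exp_generic)
    show "norm (c i m * t ^ m) \<le> C * ((K * \<bar>t\<bar>) ^ m /\<^sub>R fact m)" if "m \<ge> 0" for m
    proof -
      have "\<bar>vec_index (v m) i\<bar> * \<bar>t\<bar> ^ m \<le> C * K ^ m * \<bar>t\<bar> ^ m"
        by (intro mult_right_mono bound[OF \<open>i < n\<close>]) auto
      then show ?thesis
        by (simp add: c_def abs_mult power_abs power_mult_distrib divide_simps mult_ac)
    qed
  qed
  define f where "f i t = (\<Sum>m. c i m * t ^ m)" for i t
  define x where "x t = Matrix.vec n (\<lambda>i. f i t)" for t
  have diffs_c: "diffs (c i) m = (\<Sum>j = 0..<n. A $$ (i, j) * c j m)" if "i < n" for i m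
  proof -
    have "diffs (c i) m = vec_index (v (Suc m)) i / fact m"
      by (simp add: diffs_def c_def del: of_nat_Suc)
    also have "\<dots> = (\<Sum>j = 0..<n. A $$ (i, j) * vec_index (v m) j) / fact m"
      unfolding v_Suc using index_mult_mat_vec_sum[OF A vc that] by simp
    finally show ?thesis by (simp add: c_def sum_divide_distrib)
  qed
  have df: "(f i has_real_derivative (\<Sum>j = 0..<n. A $$ (i, j) * f j t)) (at t)" if "i < n" for i t
  proof -
    have "(f i has_real_derivative (\<Sum>m. diffs (c i) m * t ^ m)) (at t)"
      unfolding f_def by (rule termdiffs_strong_converges_everywhere[OF summ[OF that]])
    also have "(\<Sum>m. diffs (c i) m * t ^ m) = (\<Sum>m. \<Sum>j = 0..<n. A $$ (i, j) * (c j m * t ^ m))"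
      by (simp add: diffs_c[OF that] sum_distrib_right mult.assoc)
    also have "\<dots> = (\<Sum>j = 0..<n. A $$ (i, j) * f j t)"
      unfolding f_def by (subst suminf_sum) (auto intro!: sum.cong suminf_mult summable_mult summ)
    finally show ?thesis .
  qed
  have xc: "x t \<in> carrier_vec n" for t by (simp add: x_def)
  have "linear_solution n A x"
    unfolding linear_solution_def
  proof (intro conjI allI impI xc)
    fix t :: real and i assume "i < n"
    have "vec_index (A *\<^sub>v x t) i = (\<Sum>j = 0..<n. A $$ (i, j) * f j t)"
      using index_mult_mat_vec_sum[OF A xc \<open>i < n\<close>, of t] by (simp add: x_def)
    then show "((\<lambda>s. vec_index (x s) i) has_real_derivative vec_index (A *\<^sub>v x t) i) (at t within {0..})"
      using df[OF \<open>i < n\<close>, of t] \<open>i < n\<close> by (simp add: x_def has_field_derivative_at_within)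
  qed
  moreover have "x 0 = x0"
  proof (rule eq_vecI)
    fix i assume "i < dim_vec x0"
    then have "i < n" using x0 by simp
    have "f i 0 = c i 0" unfolding f_def using powser_zero[of "c i"] by simp
    then show "vec_index (x 0) i = vec_index x0 i" using \<open>i < n\<close> by (simp add: x_def c_def v_def)
  qed (use x0 in \<open>simp add: x_def\<close>)
  ultimately show ?thesis by (rule that)
qed

section \<open>Deflation by a projection\<close>

lemma char_poly_four_block_diag:
  fixes B D :: "'a :: idom mat"
  assumes B: "B \<in> carrier_mat k k" and D: "D \<in> carrier_mat m m"
  shows "char_poly (four_block_mat B (0\<^sub>m k m) (0\<^sub>m m k) D) = char_poly B * char_poly D"
proof -
  have "char_poly_matrix (four_block_mat B (0\<^sub>m k m) (0\<^sub>m m k) D) =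
      four_block_mat (char_poly_matrix B) (0\<^sub>m k m) (0\<^sub>m m k) (char_poly_matrix D)"
    using B D by (intro eq_matI) (auto simp: char_poly_matrix_def)
  then show ?thesis
    unfolding char_poly_def
    using det_four_block_mat_lower_left_zero[of "char_poly_matrix B" k "0\<^sub>m k m" m "0\<^sub>m m k" "char_poly_matrix D"] B D
    by simp
qed

lemma char_poly_scalar_mat:
  "char_poly (c \<cdot>\<^sub>m 1\<^sub>m k) = [:- c, 1:] ^ k"
proof -
  have "upper_triangular (c \<cdot>\<^sub>m 1\<^sub>m k)" by (auto simp: upper_triangular_def)
  moreover have "diag_mat (c \<cdot>\<^sub>m 1\<^sub>m k) = replicate k c"
    by (auto simp: diag_mat_def intro: nth_equalityI)
  ultimately show ?thesis
    by (subst char_poly_upper_triangular[of _ k]) auto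
qed

abbreviation corner_one :: "nat \<Rightarrow> nat \<Rightarrow> 'a :: {zero,one} mat" where
  "corner_one n k \<equiv> four_block_mat (1\<^sub>m k) (0\<^sub>m k (n - k)) (0\<^sub>m (n - k) k) (0\<^sub>m (n - k) (n - k))"

lemma corner_one_index:
  assumes "k \<le> n" "i < n" "j < n"
  shows "corner_one n k $$ (i, j) = (if i = j \<and> i < k then 1 else 0)"
  using assms by (subst index_mat_four_block) auto

lemma corner_one_carrier: "k \<le> n \<Longrightarrow> corner_one n k \<in> carrier_mat n n"
  using four_block_carrier_mat[of "1\<^sub>m k" k k "0\<^sub>m (n - k) (n - k)" "n - k" "n - k"] by simp

lemma mult_corner_one_index:
  fixes X :: "'a :: semiring_1 mat"
  assumes "k \<le> n" "X \<in> carrier_mat n n" "i < n" "j < n"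
  shows "(X * corner_one n k) $$ (i, j) = (if j < k then X $$ (i, j) else 0)"
proof -
  have "(X * corner_one n k) $$ (i, j) = (\<Sum>l = 0..<n. X $$ (i, l) * corner_one n k $$ (l, j))"
    using assms by (simp add: scalar_prod_def)
  also have "\<dots> = (\<Sum>l = 0..<n. if l = j then (if j < k then X $$ (i, j) else 0) else 0)"
    by (rule sum.cong[OF refl]) (use assms in \<open>simp del: index_mat_four_block add: corner_one_index\<close>)
  finally show ?thesis using assms by simp
qed

lemma corner_one_mult_index:
  fixes X :: "'a :: semiring_1 mat"
  assumes "k \<le> n" "X \<in> carrier_mat n n" "i < n" "j < n"
  shows "(corner_one n k * X) $$ (i, j) = (if i < k then X $$ (i, j) else 0)"
proof -
  have "(corner_one n k * X) $$ (i, j) = (\<Sum>l = 0..<n. corner_one n k $$ (i, l) * X $$ (l, j))"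
    using assms by (simp add: scalar_prod_def)
  also have "\<dots> = (\<Sum>l = 0..<n. if l = i then (if i < k then X $$ (i, j) else 0) else 0)"
    by (rule sum.cong[OF refl]) (use assms in \<open>simp del: index_mat_four_block add: corner_one_index\<close>)
  finally show ?thesis using assms by simp
qed

lemma annihilates_projection_iff:
  fixes A T S :: "'a :: comm_ring_1 mat"
  assumes k: "k \<le> n" and A: "A \<in> carrier_mat n n" and T: "T \<in> carrier_mat n n" and S: "S \<in> carrier_mat n n"
    and TS: "T * S = 1\<^sub>m n" and ST: "S * T = 1\<^sub>m n"
  shows "A * (T * corner_one n k * S) = 0\<^sub>m n n \<longleftrightarrow> (\<forall>i<k. A *\<^sub>v Matrix.col T i = 0\<^sub>v n)"
    and "(T * corner_one n k * S) * A = 0\<^sub>m n n \<longleftrightarrow> (\<forall>i<k. mat_of_row (Matrix.row S i) * A = 0\<^sub>m 1 n)"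
proof -
  define D :: "'a mat" where "D = corner_one n k"
  have D: "D \<in> carrier_mat n n" unfolding D_def by (rule corner_one_carrier[OF k])
  note assoc = assoc_mult_mat[of _ n n _ n _ n]
  have AT: "A * T \<in> carrier_mat n n" and SA: "S * A \<in> carrier_mat n n" using A T S by auto
  have "A * (T * D * S) = 0\<^sub>m n n \<longleftrightarrow> A * T * D = 0\<^sub>m n n"
  proof
    assume *: "A * (T * D * S) = 0\<^sub>m n n"
    have "A * T * D = A * (T * D * S) * T"
      using A T S D ST by (simp add: assoc)
    then show "A * T * D = 0\<^sub>m n n" using * T by simp
  next
    assume *: "A * T * D = 0\<^sub>m n n"
    have "A * (T * D * S) = A * T * D * S" using A T S D by (simp add: assoc)
    then show "A * (T * D * S) = 0\<^sub>m n n" using * S by simp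
  qed
  also have "\<dots> \<longleftrightarrow> (\<forall>i<n. \<forall>j<n. (A * T * D) $$ (i, j) = 0)"
    using AT D by (auto simp: mat_eq_iff simp del: index_mult_mat(1))
  also have "\<dots> \<longleftrightarrow> (\<forall>i<n. \<forall>j<k. (A * T) $$ (i, j) = 0)"
    using mult_corner_one_index[OF k AT, folded D_def] k
    by (auto simp del: index_mult_mat(1))
  also have "\<dots> \<longleftrightarrow> (\<forall>i<k. A *\<^sub>v Matrix.col T i = 0\<^sub>v n)"
  proof -
    have "(A * T) $$ (i, j) = vec_index (A *\<^sub>v Matrix.col T j) i" if "i < n" "j < k" for i j
      using A T k that by simp
    moreover have "A *\<^sub>v Matrix.col T j = 0\<^sub>v n \<longleftrightarrow> (\<forall>i<n. vec_index (A *\<^sub>v Matrix.col T j) i = 0)" for j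
      using A by (subst Matrix.vec_eq_iff) (simp del: index_mult_mat_vec)
    ultimately show ?thesis by metis
  qed
  finally show "A * (T * corner_one n k * S) = 0\<^sub>m n n \<longleftrightarrow> (\<forall>i<k. A *\<^sub>v Matrix.col T i = 0\<^sub>v n)"
    unfolding D_def .
  have "(T * D * S) * A = 0\<^sub>m n n \<longleftrightarrow> D * (S * A) = 0\<^sub>m n n"
  proof
    assume *: "(T * D * S) * A = 0\<^sub>m n n"
    have "D * (S * A) = (S * T) * (D * (S * A))" using A S D ST by simp
    also have "\<dots> = S * (T * D * S * A)" using A T S D by (simp add: assoc)
    finally show "D * (S * A) = 0\<^sub>m n n" using * S by simp
  next
    assume *: "D * (S * A) = 0\<^sub>m n n"
    have "(T * D * S) * A = T * (D * (S * A))" using A T S D by (simp add: assoc)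
    then show "(T * D * S) * A = 0\<^sub>m n n" using * T by simp
  qed
  also have "\<dots> \<longleftrightarrow> (\<forall>i<n. \<forall>j<n. (D * (S * A)) $$ (i, j) = 0)"
    using SA D by (auto simp: mat_eq_iff simp del: index_mult_mat(1))
  also have "\<dots> \<longleftrightarrow> (\<forall>i<k. \<forall>j<n. (S * A) $$ (i, j) = 0)"
    using corner_one_mult_index[OF k SA, folded D_def] k
    by (auto simp del: index_mult_mat(1))
  also have "\<dots> \<longleftrightarrow> (\<forall>i<k. mat_of_row (Matrix.row S i) * A = 0\<^sub>m 1 n)"
    using A S k by (auto simp: mat_eq_iff)
  finally show "(T * corner_one n k * S) * A = 0\<^sub>m n n \<longleftrightarrow> (\<forall>i<k. mat_of_row (Matrix.row S i) * A = 0\<^sub>m 1 n)"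
    unfolding D_def .
qed

text \<open>
  In the coordinates of \<open>T\<close> the annihilation conditions say that \<open>A\<close> is block diagonal with an upper
  left block zero. Subtracting \<open>W\<close> replaces this block by \<open>- 1\<close> and keeps the other block, whose
  characteristic polynomial is \<open>q\<close>. So the deflation moves the \<open>k\<close> zero eigenvalues that belong to the
  agreement space to the stable point \<open>- 1\<close>.
\<close>

lemma char_poly_deflation:
  fixes A T S :: "'a :: idom mat"
  assumes k: "k \<le> n" and A: "A \<in> carrier_mat n n" and T: "T \<in> carrier_mat n n" and S: "S \<in> carrier_mat n n"
    and TS: "T * S = 1\<^sub>m n" and ST: "S * T = 1\<^sub>m n"
    and W: "W = T * corner_one n k * S" and AW: "A * W = 0\<^sub>m n n" and WA: "W * A = 0\<^sub>m n n"
  obtains q where "char_poly A = [:0, 1:] ^ k * q" "char_poly (A - W) = [:1, 1:] ^ k * q"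
proof -
  define D :: "'a mat" where "D = corner_one n k"
  have D: "D \<in> carrier_mat n n" unfolding D_def by (rule corner_one_carrier[OF k])
  have D_index: "D $$ (i, j) = (if i = j \<and> i < k then 1 else 0)" if "i < n" "j < n" for i j
    unfolding D_def by (rule corner_one_index[OF k that])
  note assoc = assoc_mult_mat[of _ n n _ n _ n]
  have W: "W = T * D * S" unfolding D_def by (rule W)
  define M where "M = S * A * T"
  have M: "M \<in> carrier_mat n n" using A T S by (simp add: M_def)
  have Wc: "W \<in> carrier_mat n n" using T S D unfolding W by simp
  have "M * D = S * (A * W) * T"
    unfolding M_def W using A T S D ST by (simp add: assoc)
  then have MD: "M * D = 0\<^sub>m n n" using S T by (simp add: AW)
  have "D * M = (S * T) * (D * M)" using M D ST by simp
  also have "\<dots> = S * (W * A) * T" unfolding M_def W using A T S D by (simp add: assoc)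
  finally have DM: "D * M = 0\<^sub>m n n" using S T by (simp add: WA)
  have M0: "M $$ (i, j) = 0" if "i < n" "j < n" "i < k \<or> j < k" for i j
    using mult_corner_one_index[OF k M that(1,2), folded D_def]
      corner_one_mult_index[OF k M that(1,2), folded D_def] that
    unfolding MD DM by (auto split: if_splits)
  define B where "B = Matrix.mat (n - k) (n - k) (\<lambda>(i, j). M $$ (i + k, j + k))"
  have B: "B \<in> carrier_mat (n - k) (n - k)" by (simp add: B_def)
  let ?blk = "\<lambda>c. four_block_mat (c \<cdot>\<^sub>m 1\<^sub>m k) (0\<^sub>m k (n - k)) (0\<^sub>m (n - k) k) B"
  have M_blk: "M = ?blk 0"
    using M k by (intro eq_matI) (auto simp: B_def M0)
  have MD_blk: "M - D = ?blk (- 1)"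
    using M D k by (intro eq_matI) (auto simp: B_def M0 D_index)
  have A_eq: "A = T * M * S"
  proof -
    have "T * M * S = (T * S) * A * (T * S)" unfolding M_def using A T S by (simp add: assoc)
    then show ?thesis using TS A by simp
  qed
  have simA: "similar_mat A M"
    by (rule similar_matI[where P = T and Q = S, OF _ TS ST A_eq]) (use A M T S in auto)
  have simAW: "similar_mat (A - W) (M - D)"
  proof (rule similar_matI[where P = T and Q = S, OF _ TS ST])
    have "T * (M - D) = T * M - T * D" by (rule mult_minus_distrib_mat[OF T M D])
    moreover have "(T * M - T * D) * S = T * M * S - T * D * S"
      by (rule minus_mult_distrib_mat) (use M D T S in auto)
    ultimately show "A - W = T * (M - D) * S" using A_eq W by simp
    show "{A - W, M - D, T, S} \<subseteq> carrier_mat n n"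
      using Wc D T S by (auto intro: minus_carrier_mat)
  qed
  have cp: "char_poly (?blk c) = [:- c, 1:] ^ k * char_poly B" for c
    by (subst char_poly_four_block_diag[OF _ B]) (auto simp: char_poly_scalar_mat)
  have "char_poly A = [:0, 1:] ^ k * char_poly B"
    unfolding char_poly_similar[OF simA] M_blk cp by simp
  moreover have "char_poly (A - W) = [:1, 1:] ^ k * char_poly B"
    unfolding char_poly_similar[OF simAW] MD_blk cp by simp
  ultimately show ?thesis by (rule that)
qed

lemma coeff_family_poly:
  "coeff (family_poly G a m) j = (if j = m then 1 else if j < m then family_coeff G a (m - j) else 0)"
proof -
  have "coeff (family_poly G a m) j =
      (if j = m then 1 else 0) + (\<Sum>l = 1..m. if m - l = j then family_coeff G a l else 0)"
    by (auto simp: family_poly_def coeff_sum)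
  also have "(\<Sum>l = 1..m. if m - l = j then family_coeff G a l else 0) =
      (\<Sum>l = 1..m. if l = m - j then (if j < m then family_coeff G a l else 0) else 0)"
    by (rule sum.cong) auto
  finally show ?thesis by (auto simp: sum.delta)
qed

lemma family_poly_eqI:
  assumes E: "E \<subseteq> {0..<n} \<times> {0..<n}" and k: "k \<le> n"
    and q: "char_poly (edge_matrix n E a) = [:0, 1:] ^ k * q"
  shows "family_poly (digraph_of n E) a (n - k) = q"
proof (rule poly_eqI)
  fix j
  let ?A = "edge_matrix n E a"
  have A: "?A \<in> carrier_mat n n" by (simp add: edge_matrix_def)
  have "char_poly ?A = monom 1 k * q" using q by (simp add: monom_altdef)
  then have c: "coeff q j = coeff (char_poly ?A) (j + k)" by (simp add: coeff_monom_mult)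
  consider "j < n - k" | "j = n - k" | "j > n - k" by linarith
  then show "coeff (family_poly (digraph_of n E) a (n - k)) j = coeff q j"
  proof cases
    case 1
    then have "j + k = n - (n - k - j)" by simp
    then show ?thesis
      using 1 coeff_char_poly_edge_matrix[OF E, of "n - k - j" a] c by (simp add: coeff_family_poly add.commute)
  next
    case 2
    then show ?thesis using c k degree_monic_char_poly[OF A] by (simp add: coeff_family_poly)
  next
    case 3
    then show ?thesis using c k degree_monic_char_poly[OF A]
      by (auto simp: coeff_family_poly intro!: coeff_eq_0)
  qed
qed

lemma stable_poly_mult_power:
  "stable_poly ([:1, 1:] ^ k * q) \<longleftrightarrow> stable_poly q"
proof -
  interpret h: map_poly_comm_ring_hom complex_of_real ..
  have "map_poly complex_of_real ([:1, 1:] ^ k * q) = [:1, 1:] ^ k * map_poly complex_of_real q"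
    by (simp add: h.hom_mult h.hom_power)
  moreover have "Re z < 0" if "1 + z = 0" for z :: complex
    using that by (simp add: complex_eq_iff)
  ultimately show ?thesis unfolding stable_poly_def by auto
qed

section \<open>Agreement and the deflated matrix\<close>

lemma derivative_limit_0:
  fixes f :: "real \<Rightarrow> real"
  assumes deriv: "\<And>t. t \<ge> 0 \<Longrightarrow> (f has_real_derivative f' t) (at t within {0..})"
    and f: "(f \<longlongrightarrow> l) at_top" and f': "(f' \<longlongrightarrow> m) at_top"
  shows "m = 0"
proof (rule ccontr)
  assume "m \<noteq> 0"
  define e where "e = \<bar>m\<bar> / 4"
  have e: "e > 0" using \<open>m \<noteq> 0\<close> by (simp add: e_def)
  obtain N1 where N1: "\<And>t. t \<ge> N1 \<Longrightarrow> dist (f t) l < e"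
    using tendstoD[OF f e] by (auto simp: eventually_at_top_linorder)
  obtain N2 where N2: "\<And>t. t \<ge> N2 \<Longrightarrow> dist (f' t) m < e"
    using tendstoD[OF f' e] by (auto simp: eventually_at_top_linorder)
  define t where "t = max 1 (max N1 N2)"
  have "\<exists>s>t. s < t + 1 \<and> f (t + 1) - f t = (t + 1 - t) * f' s"
  proof (rule MVT2)
    fix s assume "t \<le> s"
    then have s: "s > 0" by (simp add: t_def)
    then have "(f has_real_derivative f' s) (at s within {0<..})"
      by (intro DERIV_subset[OF deriv]) auto
    then show "(f has_real_derivative f' s) (at s)"
      using s by (simp add: at_within_open[of s "{0<..}"])
  qed simp
  then obtain s where s: "s > t" "f (t + 1) - f t = f' s" by auto
  have "dist (f t) l < e" "dist (f (t + 1)) l < e" "dist (f' s) m < e"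
    using s(1) by (auto intro!: N1 N2 simp: t_def)
  then show False using s(2) \<open>m \<noteq> 0\<close> unfolding dist_real_def e_def by linarith
qed

lemma linear_solution_mult:
  assumes A: "A \<in> carrier_mat n n" and x: "linear_solution n A x"
  shows "linear_solution n A (\<lambda>t. A *\<^sub>v x t)"
  unfolding linear_solution_def
proof (intro conjI allI impI)
  have xc: "x t \<in> carrier_vec n" if "t \<ge> 0" for t using x that by (simp add: linear_solution_def)
  show "A *\<^sub>v x t \<in> carrier_vec n" if "t \<ge> 0" for t using A xc[OF that] by simp
  fix t :: real and i assume t: "t \<ge> 0" and i: "i < n"
  have "((\<lambda>s. \<Sum>j = 0..<n. A $$ (i, j) * vec_index (x s) j) has_real_derivative
      (\<Sum>j = 0..<n. A $$ (i, j) * vec_index (A *\<^sub>v x t) j)) (at t within {0..})"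
    by (intro DERIV_sum DERIV_cmult) (use x t in \<open>auto simp: linear_solution_def\<close>)
  also have "(\<Sum>j = 0..<n. A $$ (i, j) * vec_index (A *\<^sub>v x t) j) = vec_index (A *\<^sub>v (A *\<^sub>v x t)) i"
    by (rule index_mult_mat_vec_sum[symmetric, OF A _ i]) (use A xc[OF t] in simp)
  finally show "((\<lambda>s. vec_index (A *\<^sub>v x s) i) has_real_derivative vec_index (A *\<^sub>v (A *\<^sub>v x t)) i)
      (at t within {0..})"
    by (rule has_field_derivative_transform_within[where d = 1])
       (use t index_mult_mat_vec_sum[OF A xc i] in auto)
qed

lemma tendsto_mult_mat_vec:
  fixes A :: "real mat" and x :: "real \<Rightarrow> real Matrix.vec"
  assumes A: "A \<in> carrier_mat n n" and i: "i < n"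
    and x: "\<And>t. t \<ge> 0 \<Longrightarrow> x t \<in> carrier_vec n" and l: "l \<in> carrier_vec n"
    and lim: "\<And>j. j < n \<Longrightarrow> ((\<lambda>t. vec_index (x t) j) \<longlongrightarrow> vec_index l j) at_top"
  shows "((\<lambda>t. vec_index (A *\<^sub>v x t) i) \<longlongrightarrow> vec_index (A *\<^sub>v l) i) at_top"
proof -
  have "((\<lambda>t. \<Sum>j = 0..<n. A $$ (i, j) * vec_index (x t) j) \<longlongrightarrow>
      (\<Sum>j = 0..<n. A $$ (i, j) * vec_index l j)) at_top"
    by (intro tendsto_sum tendsto_mult_left lim) auto
  then have "((\<lambda>t. \<Sum>j = 0..<n. A $$ (i, j) * vec_index (x t) j) \<longlongrightarrow> vec_index (A *\<^sub>v l) i) at_top"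
    unfolding index_mult_mat_vec_sum[OF A l i] .
  moreover have "\<forall>\<^sub>F t in at_top. (\<Sum>j = 0..<n. A $$ (i, j) * vec_index (x t) j) = vec_index (A *\<^sub>v x t) i"
    using eventually_ge_at_top[of "0 :: real"]
    by eventually_elim (use index_mult_mat_vec_sum[OF A x i] in simp)
  ultimately show ?thesis by (rule Lim_transform_eventually)
qed

lemma mat_eq_0I:
  fixes M :: "'a :: semiring_1 mat"
  assumes M: "M \<in> carrier_mat n n" and 0: "\<And>x i. x \<in> carrier_vec n \<Longrightarrow> i < n \<Longrightarrow> vec_index (M *\<^sub>v x) i = 0"
  shows "M = 0\<^sub>m n n"
proof (rule eq_matI)
  fix i j assume "i < dim_row (0\<^sub>m n n :: 'a mat)" "j < dim_col (0\<^sub>m n n :: 'a mat)"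
  then have ij: "i < n" "j < n" by auto
  have "vec_index (M *\<^sub>v unit_vec n j) i = M $$ (i, j)" using M ij by simp
  then show "M $$ (i, j) = 0\<^sub>m n n $$ (i, j)" using 0[of "unit_vec n j" i] ij by simp
qed (use M in auto)

text \<open>
  The real part of \<open>exp (z t) v\<close>. Applied to the eigenvector \<open>- \<i> v\<close> it also gives the imaginary part.
\<close>

lemma exponential_solution:
  fixes A :: "real mat"
  assumes A: "A \<in> carrier_mat n n" and v: "v \<in> carrier_vec n"
    and ev: "map_mat complex_of_real A *\<^sub>v v = z \<cdot>\<^sub>v v"
  shows "linear_solution n A (\<lambda>t. Matrix.vec n (\<lambda>i. Re (exp (z * of_real t) * vec_index v i)))"
  unfolding linear_solution_def
proof (intro conjI allI impI)
  let ?A = "map_mat complex_of_real A"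
  fix t :: real and i assume i: "i < n"
  have "((\<lambda>w. exp (z * w) * vec_index v i) has_field_derivative
      z * exp (z * of_real t) * vec_index v i) (at (of_real t))"
    by (auto intro!: derivative_eq_intros)
  then have "((\<lambda>s. exp (z * of_real s) * vec_index v i) has_vector_derivative
      z * exp (z * of_real t) * vec_index v i) (at t within {0..})"
    by (rule has_vector_derivative_real_field)
  then have "((\<lambda>s. Re (exp (z * of_real s) * vec_index v i)) has_vector_derivative
      Re (z * exp (z * of_real t) * vec_index v i)) (at t within {0..})"
    by (rule bounded_linear.has_vector_derivative[OF bounded_linear_Re])
  moreover have "Re (z * exp (z * of_real t) * vec_index v i) =
      vec_index (A *\<^sub>v Matrix.vec n (\<lambda>i. Re (exp (z * of_real t) * vec_index v i))) i"
  proof -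
    have "z * vec_index v i = vec_index (?A *\<^sub>v v) i" using ev i v by simp
    also have "\<dots> = (\<Sum>j = 0..<n. ?A $$ (i, j) * vec_index v j)"
      by (rule index_mult_mat_vec_sum[OF _ v i]) (use A in simp)
    also have "\<dots> = (\<Sum>j = 0..<n. of_real (A $$ (i, j)) * vec_index v j)"
      using A i by (intro sum.cong) auto
    finally have ev_i: "z * vec_index v i = (\<Sum>j = 0..<n. of_real (A $$ (i, j)) * vec_index v j)" .
    have "z * exp (z * of_real t) * vec_index v i = exp (z * of_real t) * (z * vec_index v i)" by simp
    also have "\<dots> = exp (z * of_real t) * (\<Sum>j = 0..<n. of_real (A $$ (i, j)) * vec_index v j)"
      by (simp only: ev_i)
    also have "\<dots> = (\<Sum>j = 0..<n. of_real (A $$ (i, j)) * (exp (z * of_real t) * vec_index v j))"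
      by (simp add: sum_distrib_left mult.left_commute)
    finally have "Re (z * exp (z * of_real t) * vec_index v i) =
        (\<Sum>j = 0..<n. A $$ (i, j) * Re (exp (z * of_real t) * vec_index v j))"
      by simp
    also have "\<dots> = vec_index (A *\<^sub>v Matrix.vec n (\<lambda>i. Re (exp (z * of_real t) * vec_index v i))) i"
      by (subst index_mult_mat_vec_sum[OF A _ i]) auto
    finally show ?thesis .
  qed
  ultimately show "((\<lambda>s. vec_index (Matrix.vec n (\<lambda>i. Re (exp (z * of_real s) * vec_index v i))) i)
      has_real_derivative vec_index (A *\<^sub>v Matrix.vec n (\<lambda>i. Re (exp (z * of_real t) * vec_index v i))) i)
      (at t within {0..})"
    using i by (simp add: has_real_derivative_iff_has_vector_derivative)
qed auto


text \<open>
  From \<open>W A = 0\<close> the vector \<open>W x(t)\<close> is constant, and \<open>A\<close> does not see it because \<open>A W = 0\<close>. On the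
  difference \<open>x t - W x(0)\<close>, which \<open>W\<close> annihilates, \<open>A\<close> and \<open>A - W\<close> coincide.
\<close>

lemma linear_solution_deflation:
  fixes A W :: "real mat"
  assumes A: "A \<in> carrier_mat n n" and W: "W \<in> carrier_mat n n" and WW: "W * W = W"
    and AW: "A * W = 0\<^sub>m n n" and WA: "W * A = 0\<^sub>m n n" and x: "linear_solution n A x"
  shows "linear_solution n (A - W) (\<lambda>t. x t - W *\<^sub>v x 0)"
proof -
  have xc: "x t \<in> carrier_vec n" if "t \<ge> 0" for t using x that by (simp add: linear_solution_def)
  have dx: "((\<lambda>s. vec_index (x s) i) has_real_derivative vec_index (A *\<^sub>v x t) i) (at t within {0..})"
    if "t \<ge> 0" "i < n" for t i using x that by (simp add: linear_solution_def)
  have W_const: "W *\<^sub>v x t = W *\<^sub>v x 0" if t: "t \<ge> 0" for t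
  proof (rule eq_vecI)
    fix i assume "i < dim_vec (W *\<^sub>v x 0)"
    then have i: "i < n" using W by simp
    let ?f = "\<lambda>s. \<Sum>j = 0..<n. W $$ (i, j) * vec_index (x s) j"
    have "(?f has_field_derivative 0) (at s within {0..})" if s: "s \<in> {0..}" for s
    proof -
      have "(?f has_field_derivative (\<Sum>j = 0..<n. W $$ (i, j) * vec_index (A *\<^sub>v x s) j)) (at s within {0..})"
        by (intro DERIV_sum DERIV_cmult dx) (use s in auto)
      also have "(\<Sum>j = 0..<n. W $$ (i, j) * vec_index (A *\<^sub>v x s) j) = vec_index (W *\<^sub>v (A *\<^sub>v x s)) i"
        by (rule index_mult_mat_vec_sum[symmetric, OF W _ i]) (use A xc s in auto)
      also have "W *\<^sub>v (A *\<^sub>v x s) = (W * A) *\<^sub>v x s"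
        by (rule assoc_mult_mat_vec[symmetric, OF W A xc]) (use s in simp)
      also have "\<dots> = 0\<^sub>v n" unfolding WA by (rule eq_vecI) (use xc s in auto)
      finally show ?thesis using i by simp
    qed
    then obtain c where "\<And>s. s \<in> {0..} \<Longrightarrow> ?f s = c"
      using has_field_derivative_zero_constant[of "{0..}" ?f] by (auto simp: convex_real_interval)
    then have "?f t = ?f 0" using t by simp
    then show "vec_index (W *\<^sub>v x t) i = vec_index (W *\<^sub>v x 0) i"
      unfolding index_mult_mat_vec_sum[OF W xc[OF t] i] index_mult_mat_vec_sum[OF W xc[OF order_refl] i] .
  qed (use W in simp)
  have Wx: "W *\<^sub>v x t \<in> carrier_vec n" if "t \<ge> 0" for t using W xc[OF that] by simp
  show ?thesis
    unfolding linear_solution_def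
  proof (intro conjI allI impI)
    show "x t - W *\<^sub>v x 0 \<in> carrier_vec n" if "t \<ge> 0" for t using xc[OF that] Wx[of 0] by simp
    fix t :: real and i assume t: "t \<ge> 0" and i: "i < n"
    have "(A - W) *\<^sub>v (x t - W *\<^sub>v x 0) = (A - W) *\<^sub>v x t - (A - W) *\<^sub>v (W *\<^sub>v x 0)"
      by (rule mult_minus_distrib_mat_vec) (use A W xc[OF t] Wx[of 0] in \<open>auto intro: minus_carrier_mat\<close>)
    also have "(A - W) *\<^sub>v x t = A *\<^sub>v x t - W *\<^sub>v x t"
      by (rule minus_mult_distrib_mat_vec[OF A W xc[OF t]])
    also have "(A - W) *\<^sub>v (W *\<^sub>v x 0) = A *\<^sub>v (W *\<^sub>v x 0) - W *\<^sub>v (W *\<^sub>v x 0)"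
      by (rule minus_mult_distrib_mat_vec[OF A W Wx]) simp
    also have "A *\<^sub>v (W *\<^sub>v x 0) = (A * W) *\<^sub>v x 0"
      by (rule assoc_mult_mat_vec[symmetric, OF A W xc]) simp
    also have "W *\<^sub>v (W *\<^sub>v x 0) = (W * W) *\<^sub>v x 0"
      by (rule assoc_mult_mat_vec[symmetric, OF W W xc]) simp
    finally have "vec_index ((A - W) *\<^sub>v (x t - W *\<^sub>v x 0)) i = vec_index (A *\<^sub>v x t) i"
      using i A W xc[OF t] xc[of 0] unfolding AW WW W_const[OF t] by simp
    moreover have "((\<lambda>s. vec_index (x s) i - vec_index (W *\<^sub>v x 0) i) has_real_derivative
        vec_index (A *\<^sub>v x t) i - 0) (at t within {0..})"
      by (intro DERIV_diff dx[OF t i] DERIV_const)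
    moreover have "vec_index (x s - W *\<^sub>v x 0) i = vec_index (x s) i - vec_index (W *\<^sub>v x 0) i" for s
      using i W by (subst index_minus_vec) auto
    ultimately show "((\<lambda>s. vec_index (x s - W *\<^sub>v x 0) i) has_real_derivative
        vec_index ((A - W) *\<^sub>v (x t - W *\<^sub>v x 0)) i) (at t within {0..})"
      by simp
  qed
qed

text \<open>
  If \<open>x\<close> converges to \<open>W x(0)\<close>, then its derivative \<open>A x\<close> converges to \<open>A W x(0)\<close>; a derivative
  that converges along a convergent function can only tend to zero. Moreover \<open>A x\<close> is itself a solution,
  so the assumed limit for it is \<open>W A x(0)\<close>, and this must be the same zero limit.
\<close>

lemma agreement_imp_annihilates:
  fixes A W :: "real mat"
  assumes A: "A \<in> carrier_mat n n" and W: "W \<in> carrier_mat n n"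
    and lim: "\<And>x i. linear_solution n A x \<Longrightarrow> i < n \<Longrightarrow>
      ((\<lambda>t. vec_index (x t) i) \<longlongrightarrow> vec_index (W *\<^sub>v x 0) i) at_top"
  shows "A * W = 0\<^sub>m n n" and "W * A = 0\<^sub>m n n"
proof -
  have AW: "vec_index (A *\<^sub>v (W *\<^sub>v x 0)) i = 0" if x: "linear_solution n A x" and i: "i < n" for x i
  proof (rule derivative_limit_0)
    show "((\<lambda>s. vec_index (x s) i) has_real_derivative vec_index (A *\<^sub>v x t) i) (at t within {0..})"
      if "t \<ge> 0" for t using x i that by (simp add: linear_solution_def)
    show "((\<lambda>t. vec_index (x t) i) \<longlongrightarrow> vec_index (W *\<^sub>v x 0) i) at_top" by (rule lim[OF x i])
    have xc: "x t \<in> carrier_vec n" if "t \<ge> 0" for t using x that by (simp add: linear_solution_def)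
    show "((\<lambda>t. vec_index (A *\<^sub>v x t) i) \<longlongrightarrow> vec_index (A *\<^sub>v (W *\<^sub>v x 0)) i) at_top"
      by (rule tendsto_mult_mat_vec[OF A i xc _ lim[OF x]]) (use W xc[of 0] in auto)
  qed
  show "A * W = 0\<^sub>m n n"
  proof (rule mat_eq_0I)
    fix v :: "real Matrix.vec" and i assume v: "v \<in> carrier_vec n" and i: "i < n"
    obtain x where "linear_solution n A x" "x 0 = v" using linear_solution_exists[OF A v] .
    then show "vec_index (A * W *\<^sub>v v) i = 0" using AW[of x i] i assoc_mult_mat_vec[OF A W v] by simp
  qed (use A W in simp)
  show "W * A = 0\<^sub>m n n"
  proof (rule mat_eq_0I)
    fix v :: "real Matrix.vec" and i assume v: "v \<in> carrier_vec n" and i: "i < n"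
    obtain x where x: "linear_solution n A x" "x 0 = v" using linear_solution_exists[OF A v] .
    have xc: "x t \<in> carrier_vec n" if "t \<ge> 0" for t using x that by (simp add: linear_solution_def)
    have "((\<lambda>t. vec_index (A *\<^sub>v x t) i) \<longlongrightarrow> vec_index (A *\<^sub>v (W *\<^sub>v x 0)) i) at_top"
      by (rule tendsto_mult_mat_vec[OF A i xc _ lim[OF x(1)]]) (use W xc[of 0] in auto)
    moreover have "((\<lambda>t. vec_index (A *\<^sub>v x t) i) \<longlongrightarrow> vec_index (W *\<^sub>v (A *\<^sub>v x 0)) i) at_top"
      by (rule lim[OF linear_solution_mult[OF A x(1)] i])
    ultimately have "vec_index (W *\<^sub>v (A *\<^sub>v x 0)) i = vec_index (A *\<^sub>v (W *\<^sub>v x 0)) i"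
      by (intro tendsto_unique[OF trivial_limit_at_top_linorder]) 
    then show "vec_index (W * A *\<^sub>v v) i = 0"
      using AW[OF x(1) i] x(2) assoc_mult_mat_vec[OF W A v] by simp
  qed (use A W in simp)
qed

text \<open>
  Let \<open>v\<close> be an eigenvector of \<open>A - W\<close> for \<open>z\<close> with \<open>Re z \<ge> 0\<close>. Applying \<open>W\<close> to the eigenvalue
  equation gives \<open>(1 + z) W v = 0\<close>, so \<open>W v = 0\<close> and \<open>A v = z v\<close>. The solution \<open>exp (z t) v\<close> of
  \<open>x' = A x\<close> should then tend to \<open>W v = 0\<close>, but its norm does not decrease.
\<close>

lemma agreement_imp_stable:
  fixes A W :: "real mat"
  assumes A: "A \<in> carrier_mat n n" and W: "W \<in> carrier_mat n n" and WW: "W * W = W"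
    and WA: "W * A = 0\<^sub>m n n"
    and lim: "\<And>x i. linear_solution n A x \<Longrightarrow> i < n \<Longrightarrow>
      ((\<lambda>t. vec_index (x t) i) \<longlongrightarrow> vec_index (W *\<^sub>v x 0) i) at_top"
  shows "stable_poly (char_poly (A - W))"
  unfolding stable_char_poly_iff[OF minus_carrier_mat[OF W]]
proof (intro allI impI, rule ccontr)
  let ?c = "map_mat complex_of_real"
  fix z assume "eigenvalue (?c (A - W)) z" and nonneg: "\<not> Re z < 0"
  then obtain v where v: "v \<in> carrier_vec n" "v \<noteq> 0\<^sub>v n" "?c (A - W) *\<^sub>v v = z \<cdot>\<^sub>v v"
    using W by (auto simp: eigenvalue_def eigenvector_def)
  have cA: "?c A \<in> carrier_mat n n" and cW: "?c W \<in> carrier_mat n n" using A W by auto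
  have "?c (A - W) = ?c A - ?c W" by (rule eq_matI) (use A W in auto)
  then have ev: "?c A *\<^sub>v v - ?c W *\<^sub>v v = z \<cdot>\<^sub>v v"
    using v(3) minus_mult_distrib_mat_vec[OF cA cW v(1)] by simp
  have Wv: "?c W *\<^sub>v v = 0\<^sub>v n"
  proof -
    have Av: "?c A *\<^sub>v v \<in> carrier_vec n" and Wvc: "?c W *\<^sub>v v \<in> carrier_vec n" using cA cW v(1) by auto
    have "?c W * ?c A = ?c (W * A)" by (rule of_real_hom.mat_hom_mult[symmetric, OF W A])
    also have "\<dots> = 0\<^sub>m n n" unfolding WA by (rule eq_matI) auto
    finally have "?c W *\<^sub>v (?c A *\<^sub>v v) = 0\<^sub>m n n *\<^sub>v v"
      using assoc_mult_mat_vec[OF cW cA v(1)] by simp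
    then have 1: "?c W *\<^sub>v (?c A *\<^sub>v v) = 0\<^sub>v n" using v(1) by (auto intro: eq_vecI)
    have "?c W * ?c W = ?c (W * W)" by (rule of_real_hom.mat_hom_mult[symmetric, OF W W])
    then have 2: "?c W *\<^sub>v (?c W *\<^sub>v v) = ?c W *\<^sub>v v"
      using assoc_mult_mat_vec[OF cW cW v(1)] WW by simp
    have "?c W *\<^sub>v (?c A *\<^sub>v v - ?c W *\<^sub>v v) = 0\<^sub>v n - ?c W *\<^sub>v v"
      using mult_minus_distrib_mat_vec[OF cW Av Wvc] 1 2 by simp
    moreover have "?c W *\<^sub>v (z \<cdot>\<^sub>v v) = z \<cdot>\<^sub>v (?c W *\<^sub>v v)" by (rule mult_mat_vec[OF cW v(1)])
    ultimately have eq: "0\<^sub>v n - ?c W *\<^sub>v v = z \<cdot>\<^sub>v (?c W *\<^sub>v v)" using ev by simp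
    have "1 + z \<noteq> 0" using nonneg by (auto simp: complex_eq_iff)
    have "(1 + z) * vec_index w i = 0"
      if eq: "0\<^sub>v n - w = z \<cdot>\<^sub>v w" and w: "w \<in> carrier_vec n" and i: "i < n" for w i
    proof -
      have "vec_index (0\<^sub>v n - w) i = vec_index (z \<cdot>\<^sub>v w) i" by (simp only: eq)
      then have "z * vec_index w i = - vec_index w i" using i w by simp
      then show ?thesis by (simp add: distrib_right)
    qed
    from this[OF eq Wvc] \<open>1 + z \<noteq> 0\<close> have "vec_index (?c W *\<^sub>v v) i = 0" if "i < n" for i
      using that by (metis mult_eq_0_iff)
    then show ?thesis using cW by (intro eq_vecI) (auto simp del: index_mult_mat_vec)
  qed
  have "?c A *\<^sub>v v - 0\<^sub>v n = ?c A *\<^sub>v v"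
    by (rule eq_vecI) (use cA in \<open>auto simp del: index_mult_mat_vec\<close>)
  then have Av: "?c A *\<^sub>v v = z \<cdot>\<^sub>v v" using ev unfolding Wv by metis
  have decay: "((\<lambda>t. Re (exp (z * of_real t) * vec_index u i)) \<longlongrightarrow> 0) at_top"
    if u: "u \<in> carrier_vec n" "?c A *\<^sub>v u = z \<cdot>\<^sub>v u" "?c W *\<^sub>v u = 0\<^sub>v n" and i: "i < n" for u i
  proof -
    let ?x = "\<lambda>t. Matrix.vec n (\<lambda>i. Re (exp (z * of_real t) * vec_index u i))"
    have "vec_index (W *\<^sub>v ?x 0) i = Re (\<Sum>j = 0..<n. ?c W $$ (i, j) * vec_index u j)"
      using i W by (subst index_mult_mat_vec_sum[OF W _ i]) auto
    also have "(\<Sum>j = 0..<n. ?c W $$ (i, j) * vec_index u j) = 0"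
      using index_mult_mat_vec_sum[OF cW u(1) i] u(3) i by simp
    finally have "vec_index (W *\<^sub>v ?x 0) i = 0" by simp
    with lim[OF exponential_solution[OF A u(1,2)] i] i show ?thesis by simp
  qed
  have "vec_index v i = 0" if i: "i < n" for i
  proof -
    \<comment> \<open>a second eigenvector, whose real solution is the imaginary part of the one for \<open>v\<close>\<close>
    let ?u = "- \<i> \<cdot>\<^sub>v v"
    have "?c A *\<^sub>v ?u = z \<cdot>\<^sub>v ?u"
      unfolding mult_mat_vec[OF cA v(1)] Av by (rule eq_vecI) auto
    moreover have "?c W *\<^sub>v ?u = 0\<^sub>v n"
      unfolding mult_mat_vec[OF cW v(1)] Wv by (rule eq_vecI) auto
    ultimately have "((\<lambda>t. Re (exp (z * of_real t) * vec_index ?u i)) \<longlongrightarrow> 0) at_top"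
      by (intro decay) (use v i in auto)
    moreover have "Re (w * vec_index ?u i) = Im (w * vec_index v i)" for w using v(1) i by simp
    ultimately have "((\<lambda>t. Im (exp (z * of_real t) * vec_index v i)) \<longlongrightarrow> 0) at_top" by (simp only:)
    moreover have "((\<lambda>t. Re (exp (z * of_real t) * vec_index v i)) \<longlongrightarrow> 0) at_top"
      by (rule decay[OF v(1) Av Wv i])
    ultimately have "((\<lambda>t. exp (z * of_real t) * vec_index v i) \<longlongrightarrow> 0) at_top"
      unfolding tendsto_complex_iff by simp
    then have "((\<lambda>t. norm (exp (z * of_real t) * vec_index v i)) \<longlongrightarrow> 0) at_top"
      by (rule tendsto_norm_zero)
    moreover have "\<forall>\<^sub>F t in at_top. norm (vec_index v i) \<le> norm (exp (z * of_real t) * vec_index v i)"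
      using eventually_ge_at_top[of "0 :: real"]
    proof eventually_elim
      case (elim t)
      then have "1 \<le> exp (Re z * t)" using nonneg by simp
      then have "1 * norm (vec_index v i) \<le> exp (Re z * t) * norm (vec_index v i)"
        by (rule mult_right_mono) simp
      then show ?case by (simp add: norm_mult)
    qed
    ultimately have "norm (vec_index v i) \<le> 0"
      by (intro tendsto_lowerbound[OF _ _ trivial_limit_at_top_linorder])
    then show ?thesis by simp
  qed
  then have "v = 0\<^sub>v n" using v(1) by (intro eq_vecI) auto
  with v(2) show False ..
qed

lemma agreement_iff_deflation_stable:
  fixes A W :: "real mat"
  assumes A: "A \<in> carrier_mat n n" and W: "W \<in> carrier_mat n n" and WW: "W * W = W"
  shows "reaches_agreement n k A W \<longleftrightarrow> vec_space.rank n W = k \<and>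
    A * W = 0\<^sub>m n n \<and> W * A = 0\<^sub>m n n \<and> stable_poly (char_poly (A - W))"
proof (cases "vec_space.rank n W = k")
  case True
  have carrier: "x 0 \<in> carrier_vec n" if "linear_solution n A x" for x
    using that by (simp add: linear_solution_def)
  have "reaches_agreement n k A W \<longleftrightarrow> (\<forall>x. linear_solution n A x \<longrightarrow>
      (\<forall>i<n. ((\<lambda>t. vec_index (x t) i) \<longlongrightarrow> vec_index (W *\<^sub>v x 0) i) at_top))" (is "_ \<longleftrightarrow> ?lim")
    unfolding reaches_agreement_def using True carrier by blast
  also have "\<dots> \<longleftrightarrow> A * W = 0\<^sub>m n n \<and> W * A = 0\<^sub>m n n \<and> stable_poly (char_poly (A - W))"
  proof
    assume ?lim
    then have lim: "\<And>x i. linear_solution n A x \<Longrightarrow> i < n \<Longrightarrow>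
      ((\<lambda>t. vec_index (x t) i) \<longlongrightarrow> vec_index (W *\<^sub>v x 0) i) at_top" by blast
    show "A * W = 0\<^sub>m n n \<and> W * A = 0\<^sub>m n n \<and> stable_poly (char_poly (A - W))"
      using agreement_imp_annihilates[OF A W lim] agreement_imp_stable[OF A W WW _ lim] by blast
  next
    assume *: "A * W = 0\<^sub>m n n \<and> W * A = 0\<^sub>m n n \<and> stable_poly (char_poly (A - W))"
    show ?lim
    proof (intro allI impI)
      fix x i assume x: "linear_solution n A x" and i: "i < n"
      have "((\<lambda>t. vec_index (x t - W *\<^sub>v x 0) i) \<longlongrightarrow> 0) at_top"
        by (rule stable_solution_tendsto_0[OF minus_carrier_mat[OF W] _ _ i])
           (use * linear_solution_deflation[OF A W WW _ _ x] in auto)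
      moreover have "vec_index (x t - W *\<^sub>v x 0) i = vec_index (x t) i - vec_index (W *\<^sub>v x 0) i" for t
        using i W by (subst index_minus_vec) auto
      ultimately show "((\<lambda>t. vec_index (x t) i) \<longlongrightarrow> vec_index (W *\<^sub>v x 0) i) at_top"
        by (simp only: LIM_zero_iff)
    qed
  qed
  finally show ?thesis using True by blast
qed (simp add: reaches_agreement_def)

theorem theoremV3:
  fixes n k :: nat
    and E :: "(nat \<times> nat) set"
    and a :: "nat \<times> nat \<Rightarrow> real"
    and W T T_inv :: "real mat"
  assumes "E \<subseteq> {0..<n} \<times> {0..<n}"
    and "strongly_connected (digraph_of n E)"
    and "W \<in> carrier_mat n n" and "W * W = W"
    and "vec_space.rank n W = k" and "k \<ge> 1"
    and "T \<in> carrier_mat n n" and "T_inv \<in> carrier_mat n n"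
    and "inverts_mat T T_inv" and "inverts_mat T_inv T"
    and "W = T * four_block_mat (1\<^sub>m k) (0\<^sub>m k (n - k))
                                (0\<^sub>m (n - k) k) (0\<^sub>m (n - k) (n - k)) * T_inv"
  shows "reaches_agreement n k (edge_matrix n E a) W \<longleftrightarrow>
      (\<forall>i<k. edge_matrix n E a *\<^sub>v Matrix.col T i = 0\<^sub>v n
           \<and> mat_of_row (Matrix.row T_inv i) * edge_matrix n E a = 0\<^sub>m 1 n)
    \<and> stable_poly (family_poly (digraph_of n E) a (n - k))"
proof -
  note E = assms(1) and W = assms(3) and T = assms(7) and S = assms(8) and W_eq = assms(11)
  let ?A = "edge_matrix n E a"
  have A: "?A \<in> carrier_mat n n" by (simp add: edge_matrix_def)
  have k: "k \<le> n" using vec_space.rank_le_nc[OF W] assms(5) by simp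
  have TS: "T * T_inv = 1\<^sub>m n" and ST: "T_inv * T = 1\<^sub>m n"
    using assms(7-10) by (auto simp: inverts_mat_def)
  have annihilates: "(\<forall>i<k. ?A *\<^sub>v Matrix.col T i = 0\<^sub>v n \<and> mat_of_row (Matrix.row T_inv i) * ?A = 0\<^sub>m 1 n)
      \<longleftrightarrow> ?A * W = 0\<^sub>m n n \<and> W * ?A = 0\<^sub>m n n"
    unfolding W_eq annihilates_projection_iff[OF k A T S TS ST] by blast
  have stable: "stable_poly (char_poly (?A - W)) \<longleftrightarrow> stable_poly (family_poly (digraph_of n E) a (n - k))"
    if AW: "?A * W = 0\<^sub>m n n" and WA: "W * ?A = 0\<^sub>m n n"
  proof -
    obtain q where q: "char_poly ?A = [:0, 1:] ^ k * q" "char_poly (?A - W) = [:1, 1:] ^ k * q"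
      using char_poly_deflation[OF k A T S TS ST W_eq AW WA] .
    have "family_poly (digraph_of n E) a (n - k) = q" by (rule family_poly_eqI[OF E k q(1)])
    then show ?thesis by (simp only: q(2) stable_poly_mult_power)
  qed
  show ?thesis
    unfolding agreement_iff_deflation_stable[OF A W assms(4)] annihilates
    using assms(5) stable by blast
qed

end
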